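(* Let $A$ be a semisimple unital complex Banach algebra, let $B$ be a unital complex Banach algebra, and let $\phi:A\to B$ be a surjective function (not assumed linear, multiplicative or continuous) satisfying $$\sigma\left(\prod_{i=1}^m\phi(x_i)\right)=\sigma\left(\prod_{i=1}^m x_i\right)\quad\text{for all } m\in\{1,2,3\}\text{ and all } x_1,\dots,x_m\in A.$$ Then: (i) $\phi$ is bijective; (ii) $B$ is semisimple; (iii) $\phi$ is multiplicative, i.e. $\phi(xy)=\phi(x)\phi(y)$ for all $x,y\in A$; (iv) $\phi(\mathbf 1)=\mathbf 1$, and $\phi(\lambda x)=\lambda\phi(x)$ for all $x\in A$ and $\lambda\in\mathbb C$; (v) for all $x,y\in A$: $xy=yx$ if and only if $\phi(x)\phi(y)=\phi(y)\phi(x)$; (vi) for all $x,y\in A$: $y\in C_{\{x\}}$ if and only if $\phi(y)\in C_{\{\phi(x)\}}$; (vii) for each $x\in A$, the algebra $C_{\{x\}}/\operatorname{Rad}(C_{\{x\}})$ is isomorphic to the algebra $C_{\{\phi(x)\}}/\operatorname{Rad}(C_{\{\phi(x)\}})$.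
   Context: All Banach algebras are complex and unital (and nonzero), with unit denoted $\mathbf 1$. For an element $x$ of a Banach algebra $A$ with group of invertible elements $G(A)$, the spectrum is $\sigma(x)=\{\lambda\in\mathbb C:\lambda\mathbf 1-x\notin G(A)\}$; in an equation such as the spectral hypothesis, the spectrum on the left is taken in $B$ and the one on the right in $A$. $\operatorname{Rad}(A)$ denotes the (Jacobson) radical of $A$, and $A$ is semisimple if $\operatorname{Rad}(A)=\{0\}$. For $x$ in a Banach algebra, $C_{\{x\}}$ denotes the bicommutant of the set $\{x\}$ in that algebra, i.e. the set of all elements commuting with every element that commutes with $x$ (so $C_{\{x\}}$ is taken in $A$ and $C_{\{\phi(x)\}}$ in $B$); it is a commutative unital Banach algebra. "Isomorphic" means isomorphic as complex algebras (via a linear multiplicative bijection). *)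

theory Defs
  imports Complex_Main "HOL-Algebra.QuotRing" "HOL-Algebra.Module"
begin

class scaleC =
  fixes scaleC :: "complex \<Rightarrow> 'a \<Rightarrow> 'a"  (infixr \<open>*\<^sub>C\<close> 75)

text \<open>
  Nonzero unital complex Banach algebras. The norm is submultiplicative, but \<open>norm 1 = 1\<close>
  is not required; \<open>0 \<noteq> 1\<close> is part of \<^class>\<open>real_algebra_1\<close>. The first axiom says that the
  real structure underlying the norm is the restriction of the complex one.
\<close>

class complex_banach_algebra = real_algebra_1 + real_normed_algebra + banach + scaleC +
  assumes scaleR_scaleC: "r *\<^sub>R x = complex_of_real r *\<^sub>C x"
    and scaleC_add_right: "a *\<^sub>C (x + y) = a *\<^sub>C x + a *\<^sub>C y"
    and scaleC_add_left: "(a + b) *\<^sub>C x = a *\<^sub>C x + b *\<^sub>C x"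
    and scaleC_scaleC: "a *\<^sub>C b *\<^sub>C x = (a * b) *\<^sub>C x"
    and scaleC_one: "1 *\<^sub>C x = x"
    and mult_scaleC_left: "a *\<^sub>C x * y = a *\<^sub>C (x * y)"
    and mult_scaleC_right: "x * a *\<^sub>C y = a *\<^sub>C (x * y)"
    and norm_scaleC: "norm (a *\<^sub>C x) = cmod a * norm x"

instantiation complex :: complex_banach_algebra
begin
definition scaleC_complex_def: "a *\<^sub>C (x::complex) = a * x"
instance
  by standard (simp_all add: scaleC_complex_def scaleR_conv_of_real algebra_simps norm_mult)
end

definition invertibles :: "'a::complex_banach_algebra set" where
  "invertibles = {x. \<exists>y. x * y = 1 \<and> y * x = 1}"

definition spectrum :: "'a::complex_banach_algebra \<Rightarrow> complex set" where
  "spectrum x = {z. z *\<^sub>C 1 - x \<notin> invertibles}"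

text \<open>
  Left ideals and the Jacobson radical are taken relative to a unital subring \<open>S\<close>, so that
  they apply both to the whole algebra (\<open>S = UNIV\<close>) and to bicommutants. Closure under
  negation is automatic, since \<open>-1 \<in> S\<close>.
\<close>

definition left_ideal :: "'a::ring_1 set \<Rightarrow> 'a set \<Rightarrow> bool" where
  "left_ideal S I \<longleftrightarrow> I \<subseteq> S \<and> 0 \<in> I \<and> (\<forall>x\<in>I. \<forall>y\<in>I. x + y \<in> I) \<and> (\<forall>s\<in>S. \<forall>x\<in>I. s * x \<in> I)"

definition maximal_left_ideal :: "'a::ring_1 set \<Rightarrow> 'a set \<Rightarrow> bool" where
  "maximal_left_ideal S I \<longleftrightarrow> left_ideal S I \<and> I \<noteq> S \<and>
     (\<forall>J. left_ideal S J \<longrightarrow> I \<subseteq> J \<longrightarrow> J = I \<or> J = S)"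

definition Rad :: "'a::ring_1 set \<Rightarrow> 'a set" where
  "Rad S = {x \<in> S. \<forall>I. maximal_left_ideal S I \<longrightarrow> x \<in> I}"

definition semisimple :: "'a::complex_banach_algebra itself \<Rightarrow> bool" where
  "semisimple _ \<longleftrightarrow> Rad (UNIV :: 'a set) = {0}"

definition commutant :: "'a::ring_1 set \<Rightarrow> 'a set" where
  "commutant S = {y. \<forall>x\<in>S. y * x = x * y}"

definition bicommutant :: "'a::ring_1 set \<Rightarrow> 'a set" where
  "bicommutant S = commutant (commutant S)"

text \<open>
  Quotient algebras are represented by records of \<^theory>\<open>HOL-Algebra.Module\<close>: a ring
  together with a scalar multiplication.
\<close>

definition subring_of :: "'a::ring_1 set \<Rightarrow> 'a ring" where
  "subring_of S = \<lparr>carrier = S, mult = (*), one = 1, zero = 0, add = (+)\<rparr>"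

definition quotient_algebra ::
  "'a::complex_banach_algebra set \<Rightarrow> 'a set \<Rightarrow> (complex, 'a set) module" where
  "quotient_algebra S I = ring.extend (subring_of S Quot I)
     \<lparr>smult = (\<lambda>c X. \<Union>x\<in>X. I +>\<^bsub>subring_of S\<^esub> (c *\<^sub>C x))\<rparr>"

definition algebra_isomorphic ::
  "(complex, 'a) module \<Rightarrow> (complex, 'b) module \<Rightarrow> bool" where
  "algebra_isomorphic R S \<longleftrightarrow> (\<exists>h \<in> ring_iso R S.
     \<forall>c. \<forall>x\<in>carrier R. h (c \<odot>\<^bsub>R\<^esub> x) = c \<odot>\<^bsub>S\<^esub> h x)"

end

theory Submission
  imports Defs "HOL-Analysis.Analysis"
begin

text \<open>
  Write \<open>\<sigma>\<close> for the spectrum and \<open>r\<close> for the spectral radius. The theorem rests on two facts.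

  The first one is that in a semisimple algebra an element \<open>a\<close> is determined by the spectra of its
  multiples \<open>a x\<close> (\<open>difference_in_Rad\<close>). Applied in \<open>A\<close>, it makes \<open>\<phi>\<close> injective. If \<open>\<phi> x\<close> lies in the
  radical of \<open>B\<close>, then \<open>\<sigma> (x y) = \<sigma> (\<phi> x \<phi> y) = {0} = \<sigma> (0 y)\<close> for all \<open>y\<close>, so \<open>x = 0\<close>; hence the
  radical of \<open>B\<close> is the single point \<open>\<phi> 0 = 0\<close>. Applied in \<open>B\<close>, it turns
  \<open>\<sigma> (\<phi> (x y) \<phi> z) = \<sigma> (x y z) = \<sigma> (\<phi> x \<phi> y \<phi> z)\<close> into multiplicativity, and homogeneity follows in
  the same way. The claims about commutation are then formal consequences.

  The second one is that a multiplicative, homogeneous, spectrum-preserving bijection \<open>\<phi>\<close> between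
  commutative algebras \<open>C\<close> and \<open>D\<close> is additive up to quasinilpotent elements
  (\<open>additive_modulo_quasinilpotents\<close>). A bicommutant is commutative and closed under inverses, and so
  its radical is the set of its quasinilpotent elements; the second fact therefore says that \<open>\<phi>\<close> induces
  an isomorphism of the quotients (\<open>quotients_isomorphic\<close>).

  For algebras of functions the second fact would be proved with peak functions: an element \<open>g\<close> of \<open>D\<close>
  whose transform is close to one near a point and small elsewhere reads off values at this point through
  \<open>r (z g)\<close>, and \<open>\<phi>\<close> carries such numbers over to \<open>C\<close>, because \<open>r (\<phi> x \<phi> h) = r (x h)\<close>. The
  proof below works with these numbers directly. Consider the functions on \<open>D\<close> that are pointwise limits
  of \<open>z \<mapsto> r (z g)\<close> (\<open>spectral_limit\<close>). They are seminorms, and composition with \<open>\<phi>\<close> gives functions of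
  the same kind on \<open>C\<close>, which are therefore seminorms as well; this is how information about sums gets
  through \<open>\<phi>\<close>. A minimal function \<open>f\<close> among the submultiplicative ones that are compatible with squares is
  multiplicative (\<open>multiplicative_peak_seminorm_exists\<close>), and by an elementary form of the Gelfand-Mazur
  theorem it is the modulus of a character (\<open>multiplicative_seminorm_has_value\<close>). The same holds for
  \<open>f \<circ> \<phi>\<close>, and the peaking elements show that the two characters agree under \<open>\<phi>\<close>, not only their
  moduli (\<open>values_agree\<close>). Hence \<open>f\<close> vanishes at \<open>d = \<phi> (x + y) - \<phi> x - \<phi> y\<close>. If \<open>d\<close> were not
  quasinilpotent, the minimal \<open>f\<close> could be chosen among the functions peaking at \<open>d\<close>, for which
  \<open>f d = r d \<noteq> 0\<close>.

  This uses that \<open>r\<close> is submultiplicative and subadditive on commuting elements. Both are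
  consequences of the fact that some power of \<open>x\<close> has norm less than one as soon as the spectrum of \<open>x\<close> lies
  in the open unit disc (\<open>power_contractive_of_resolvent\<close>).
\<close>

section \<open>Complex scalars and invertible elements\<close>

lemma scaleC_zero_left [simp]: "0 *\<^sub>C (x::'a::complex_banach_algebra) = 0"
  using scaleC_add_left[of 0 0 x] by simp

lemma scaleC_zero_right [simp]: "a *\<^sub>C (0::'a::complex_banach_algebra) = 0"
  using scaleC_add_right[of a 0 "0::'a"] by simp

lemma scaleC_minus_left: "(- a) *\<^sub>C (x::'a::complex_banach_algebra) = - (a *\<^sub>C x)"
  using scaleC_add_left[of a "- a" x] by (simp add: eq_neg_iff_add_eq_0 add.commute)

lemma scaleC_minus_right: "a *\<^sub>C (- x::'a::complex_banach_algebra) = - (a *\<^sub>C x)"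
  using scaleC_add_right[of a x "- x"] by (simp add: eq_neg_iff_add_eq_0 add.commute)

lemma scaleC_diff_left: "(a - b) *\<^sub>C (x::'a::complex_banach_algebra) = a *\<^sub>C x - b *\<^sub>C x"
  using scaleC_add_left[of a "- b" x] by (simp add: scaleC_minus_left)

lemma scaleC_diff_right: "a *\<^sub>C (x - y::'a::complex_banach_algebra) = a *\<^sub>C x - a *\<^sub>C y"
  using scaleC_add_right[of a x "- y"] by (simp add: scaleC_minus_right)

lemma scaleC_power: "(a *\<^sub>C (x::'a::complex_banach_algebra)) ^ n = a ^ n *\<^sub>C x ^ n"
  by (induction n) (simp_all add: scaleC_one mult_scaleC_left mult_scaleC_right scaleC_scaleC mult.commute[of a])

lemmas scaleC_simps = scaleC_add_left scaleC_add_right scaleC_diff_left scaleC_diff_right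
  scaleC_minus_left scaleC_minus_right scaleC_scaleC scaleC_one mult_scaleC_left mult_scaleC_right

definition ainv :: "'a::complex_banach_algebra \<Rightarrow> 'a" where
  "ainv x = (SOME y. x * y = 1 \<and> y * x = 1)"

lemma invertiblesI: "x * y = 1 \<Longrightarrow> y * x = 1 \<Longrightarrow> x \<in> invertibles"
  by (auto simp: invertibles_def)

lemma ainv:
  assumes "x \<in> invertibles"
  shows ainv_right: "x * ainv x = 1" and ainv_left: "ainv x * x = 1"
proof -
  have "\<exists>y. x * y = 1 \<and> y * x = 1"
    using assms by (simp add: invertibles_def)
  from someI_ex[OF this] show "x * ainv x = 1" "ainv x * x = 1"
    by (simp_all add: ainv_def)
qed

lemma ainv_unique: "x * y = 1 \<Longrightarrow> y * x = 1 \<Longrightarrow> ainv x = y"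
  by (metis ainv_left invertiblesI mult.assoc mult.left_neutral mult.right_neutral)

lemma ainv_cancel_left:
  assumes "x \<in> invertibles"
  shows "x * (ainv x * y) = y" "ainv x * (x * y) = y"
  using ainv[OF assms] by (simp_all flip: mult.assoc)

lemma ainv_invertible: "x \<in> invertibles \<Longrightarrow> ainv x \<in> invertibles"
  by (metis ainv_left ainv_right invertiblesI)

lemma one_invertible: "(1::'a::complex_banach_algebra) \<in> invertibles"
  by (rule invertiblesI[of _ 1]) simp_all

lemma zero_not_invertible: "(0::'a::complex_banach_algebra) \<notin> invertibles"
  by (simp add: invertibles_def)

lemma mult_invertible: "x \<in> invertibles \<Longrightarrow> y \<in> invertibles \<Longrightarrow> x * y \<in> invertibles"
  by (rule invertiblesI[of _ "ainv y * ainv x"])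
    (simp_all add: mult.assoc ainv_cancel_left ainv_left ainv_right)

lemma mult_invertible_cancel_right:
  assumes "y \<in> invertibles"
  shows "x * y \<in> invertibles \<longleftrightarrow> x \<in> invertibles"
  using mult_invertible[of "x * y" "ainv y"] mult_invertible[of x y] ainv_invertible[OF assms] assms
  by (auto simp: mult.assoc ainv_right)

lemma commute_ainv:
  assumes "x \<in> invertibles" "y * x = x * y"
  shows "y * ainv x = ainv x * y"
  by (metis ainv_left ainv_right assms mult.assoc mult.left_neutral mult.right_neutral)

text \<open>
  For commuting \<open>x\<close> and \<open>y\<close> the element \<open>y (x y)\<inverse>\<close> is a right inverse of \<open>x\<close>, and it is a left inverse
  as well because \<open>(x y)\<inverse>\<close> commutes with \<open>x\<close>.
\<close>

lemma commuting_factor_invertible: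
  assumes "x * y = y * x" "x * y \<in> invertibles"
  shows "x \<in> invertibles"
proof (rule invertiblesI)
  let ?z = "ainv (x * y)"
  have "x * (x * y) = (x * y) * x"
    by (metis assms(1) mult.assoc)
  then have c: "x * ?z = ?z * x"
    by (rule commute_ainv[OF assms(2)])
  show "x * (y * ?z) = 1"
    using ainv_right[OF assms(2)] by (simp add: mult.assoc)
  show "y * ?z * x = 1"
    by (metis ainv_right assms c mult.assoc)
qed

lemma scaleC_invertible:
  assumes "c \<noteq> 0"
  shows "c *\<^sub>C x \<in> invertibles \<longleftrightarrow> x \<in> invertibles"
proof -
  have *: "c *\<^sub>C x \<in> invertibles" if "c \<noteq> 0" "x \<in> invertibles" for c and x :: 'a
    using ainv[OF that(2)] that(1)
    by (intro invertiblesI[of _ "(1/c) *\<^sub>C ainv x"]) (simp_all add: scaleC_simps)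
  show ?thesis
    using *[of c x] *[of "1/c" "c *\<^sub>C x"] assms by (auto simp: scaleC_simps)
qed

lemma minus_invertible: "- x \<in> invertibles \<longleftrightarrow> x \<in> invertibles"
  using scaleC_invertible[of "-1" x] by (simp add: scaleC_simps)

lemma diff_invertible_commute: "x - y \<in> invertibles \<longleftrightarrow> y - x \<in> invertibles"
  using minus_invertible[of "x - y"] by simp

text \<open>
  Jacobson's identity: if \<open>z\<close> inverts \<open>1 - x y\<close>, then \<open>1 + y z x\<close> inverts \<open>1 - y x\<close>.
\<close>

lemma one_minus_mult_invertible_commute:
  "1 - x * y \<in> invertibles \<longleftrightarrow> 1 - y * x \<in> invertibles"
proof -
  have *: "1 - y * x \<in> invertibles" if "1 - x * y \<in> invertibles" for x y :: 'a
  proof (rule invertiblesI)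
    let ?z = "ainv (1 - x * y)"
    have z: "?z - x * y * ?z = 1" "?z - ?z * x * y = 1"
      using ainv[OF that] by (simp_all add: algebra_simps)
    have "(1 - y * x) * (1 + y * ?z * x) = 1 - y * x + y * (?z - x * y * ?z) * x"
      by (simp add: algebra_simps)
    then show "(1 - y * x) * (1 + y * ?z * x) = 1" by (simp add: z)
    have "(1 + y * ?z * x) * (1 - y * x) = 1 - y * x + y * (?z - ?z * x * y) * x"
      by (simp add: algebra_simps)
    then show "(1 + y * ?z * x) * (1 - y * x) = 1" by (simp add: z)
  qed
  show ?thesis using * by blast
qed

section \<open>The radical of a unital subring\<close>

definition unital_subring :: "'a::ring_1 set \<Rightarrow> bool" where
  "unital_subring S \<longleftrightarrow> 1 \<in> S \<and> (\<forall>x\<in>S. \<forall>y\<in>S. x - y \<in> S \<and> x * y \<in> S)"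

lemma unital_subringD:
  assumes "unital_subring S"
  shows "1 \<in> S" "0 \<in> S" "x \<in> S \<Longrightarrow> y \<in> S \<Longrightarrow> x - y \<in> S" "x \<in> S \<Longrightarrow> y \<in> S \<Longrightarrow> x * y \<in> S"
    "x \<in> S \<Longrightarrow> - x \<in> S" "x \<in> S \<Longrightarrow> y \<in> S \<Longrightarrow> x + y \<in> S"
proof -
  show 1: "1 \<in> S" and d: "x \<in> S \<Longrightarrow> y \<in> S \<Longrightarrow> x - y \<in> S" and "x \<in> S \<Longrightarrow> y \<in> S \<Longrightarrow> x * y \<in> S" for x y
    using assms by (auto simp: unital_subring_def)
  show 0: "0 \<in> S" using d[OF 1 1] by simp
  show m: "x \<in> S \<Longrightarrow> - x \<in> S" for x using d[OF 0, of x] by simp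
  show "x \<in> S \<Longrightarrow> y \<in> S \<Longrightarrow> x + y \<in> S" for x y using d[of x "- y"] m[of y] by simp
qed

lemma left_ideal_eq_iff_one:
  assumes "left_ideal S I" "unital_subring S"
  shows "I = S \<longleftrightarrow> 1 \<in> I"
proof
  assume 1: "1 \<in> I"
  have "x \<in> I" if "x \<in> S" for x
  proof -
    have "x * 1 \<in> I" using assms(1) 1 that unfolding left_ideal_def by blast
    then show ?thesis by simp
  qed
  then show "I = S" using assms(1) by (auto simp: left_ideal_def)
qed (use unital_subringD[OF assms(2)] in simp)

text \<open>
  Properness of a left ideal means that it omits \<open>1\<close>, a condition that passes to unions of chains.
\<close>

lemma left_ideal_in_maximal:
  assumes S: "unital_subring S" and I: "left_ideal S I" "1 \<notin> I"
  obtains M where "maximal_left_ideal S M" "I \<subseteq> M"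
proof -
  define F where "F = {J. left_ideal S J \<and> I \<subseteq> J \<and> 1 \<notin> J}"
  have "\<exists>M\<in>F. \<forall>X\<in>F. M \<subseteq> X \<longrightarrow> X = M"
  proof (rule subset_Zorn_nonempty)
    show "F \<noteq> {}" using I by (auto simp: F_def)
    fix C assume C: "C \<noteq> {}" "subset.chain F C"
    have CF: "C \<subseteq> F" and lin: "\<And>X Y. X \<in> C \<Longrightarrow> Y \<in> C \<Longrightarrow> X \<subseteq> Y \<or> Y \<subseteq> X"
      using C(2) by (auto simp: subset_chain_def)
    have "x + y \<in> \<Union>C" if "x \<in> \<Union>C" "y \<in> \<Union>C" for x y
    proof -
      obtain X Y where XY: "X \<in> C" "Y \<in> C" "x \<in> X" "y \<in> Y" using \<open>x \<in> \<Union>C\<close> \<open>y \<in> \<Union>C\<close> by blast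
      then obtain Z where Z: "Z \<in> C" "x \<in> Z" "y \<in> Z" using lin[of X Y] by blast
      then have "left_ideal S Z" using CF by (auto simp: F_def)
      then have "x + y \<in> Z" using Z unfolding left_ideal_def by blast
      then show ?thesis using Z by blast
    qed
    moreover have mem: "left_ideal S X" "I \<subseteq> X" "1 \<notin> X" if "X \<in> C" for X
      using CF that by (auto simp: F_def)
    moreover have "s * x \<in> \<Union>C" if "s \<in> S" "x \<in> \<Union>C" for s x
      using mem(1) that unfolding left_ideal_def by blast
    moreover obtain X0 where "X0 \<in> C" using C(1) by blast
    moreover have "\<Union>C \<subseteq> S"
      using mem(1) unfolding left_ideal_def by blast
    moreover have "0 \<in> \<Union>C"
      using mem(1)[OF \<open>X0 \<in> C\<close>] \<open>X0 \<in> C\<close> by (auto simp: left_ideal_def)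
    ultimately have "left_ideal S (\<Union>C)"
      by (simp add: left_ideal_def)
    moreover have "I \<subseteq> \<Union>C" using mem(2)[OF \<open>X0 \<in> C\<close>] \<open>X0 \<in> C\<close> by blast
    moreover have "1 \<notin> \<Union>C" using mem(3) by blast
    ultimately show "\<Union>C \<in> F" by (simp add: F_def)
  qed
  then obtain M where M: "M \<in> F" "\<And>X. X \<in> F \<Longrightarrow> M \<subseteq> X \<Longrightarrow> X = M" by blast
  have "maximal_left_ideal S M"
      unfolding maximal_left_ideal_def
  proof (intro conjI allI impI)
    show "left_ideal S M" using M(1) by (simp add: F_def)
    then show "M \<noteq> S" using M(1) left_ideal_eq_iff_one[OF _ S] by (auto simp: F_def)
    fix J assume J: "left_ideal S J" "M \<subseteq> J"
    show "J = M \<or> J = S"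
    proof (cases "1 \<in> J")
      case True then show ?thesis using left_ideal_eq_iff_one[OF J(1) S] by simp
    next
      case False
      then have "J \<in> F" using J M(1) by (auto simp: F_def)
      then show ?thesis using M(2) J(2) by blast
    qed
  qed
  moreover have "I \<subseteq> M" using M(1) by (auto simp: F_def)
  ultimately show thesis by (rule that)
qed

text \<open>
  If \<open>1 - y x\<close> has no left inverse, the left ideal that it generates is proper and extends to a maximal
  one, which cannot contain \<open>x\<close>. Conversely, if a maximal left ideal \<open>I\<close> omits \<open>x\<close>, then \<open>I + S x\<close> is all of
  \<open>S\<close>, and \<open>1 - s x \<in> I\<close> for some \<open>s\<close>.
\<close>

lemma Rad_iff_left_invertible:
  assumes S: "unital_subring S"
  shows "x \<in> Rad S \<longleftrightarrow> x \<in> S \<and> (\<forall>y\<in>S. \<exists>z\<in>S. z * (1 - y * x) = 1)"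
proof
  assume x: "x \<in> Rad S"
  then have xS: "x \<in> S" by (simp add: Rad_def)
  have "\<exists>z\<in>S. z * (1 - y * x) = 1" if y: "y \<in> S" for y
  proof (rule ccontr)
    assume no: "\<not> ?thesis"
    define I where "I = (\<lambda>z. z * (1 - y * x)) ` S"
    note D = unital_subringD[OF S]
    have "left_ideal S I"
      unfolding left_ideal_def
    proof (intro conjI ballI)
      show "I \<subseteq> S" using D xS y by (auto simp: I_def)
      show "0 \<in> I" unfolding I_def using D(2) by (rule image_eqI[rotated]) simp
      fix u assume u: "u \<in> I"
      then obtain z where z: "z \<in> S" "u = z * (1 - y * x)" by (auto simp: I_def)
      show "u + v \<in> I" if "v \<in> I" for v
      proof -
        obtain w where "w \<in> S" "v = w * (1 - y * x)" using \<open>v \<in> I\<close> by (auto simp: I_def)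
        then show ?thesis unfolding I_def using z D(6)[of z w]
          by (intro image_eqI[of _ _ "z + w"]) (simp_all add: distrib_right)
      qed
      show "s * u \<in> I" if "s \<in> S" for s
        unfolding I_def using that z D(4)[of s z]
        by (intro image_eqI[of _ _ "s * z"]) (simp_all add: mult.assoc)
    qed
    moreover have "1 \<notin> I" using no by (auto simp: I_def)
    ultimately obtain M where M: "maximal_left_ideal S M" "I \<subseteq> M"
      using left_ideal_in_maximal[OF S] by blast
    have li: "left_ideal S M" using M(1) by (simp add: maximal_left_ideal_def)
    have "x \<in> M" using x M(1) by (simp add: Rad_def)
    then have "y * x \<in> M" using li y by (simp add: left_ideal_def)
    moreover have "1 - y * x \<in> I" unfolding I_def using D(1) by (rule image_eqI[rotated]) simp
    ultimately have "1 - y * x + y * x \<in> M" using li M(2) unfolding left_ideal_def by blast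
    then show False using left_ideal_eq_iff_one[OF li S] M(1)
      by (simp add: maximal_left_ideal_def)
  qed
  then show "x \<in> S \<and> (\<forall>y\<in>S. \<exists>z\<in>S. z * (1 - y * x) = 1)" using xS by blast
next
  assume x: "x \<in> S \<and> (\<forall>y\<in>S. \<exists>z\<in>S. z * (1 - y * x) = 1)"
  note D = unital_subringD[OF S]
  have "x \<in> I" if I: "maximal_left_ideal S I" for I
  proof (rule ccontr)
    assume xI: "x \<notin> I"
    have li: "left_ideal S I" and ne: "I \<noteq> S" using I by (auto simp: maximal_left_ideal_def)
    have IS: "I \<subseteq> S" and I0: "0 \<in> I" and Ia: "\<And>u v. u \<in> I \<Longrightarrow> v \<in> I \<Longrightarrow> u + v \<in> I"
      and Im: "\<And>s u. s \<in> S \<Longrightarrow> u \<in> I \<Longrightarrow> s * u \<in> I"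
      using li by (auto simp: left_ideal_def)
    define J where "J = {i + s * x | i s. i \<in> I \<and> s \<in> S}"
    have JI: "i + s * x \<in> J" if "i \<in> I" "s \<in> S" for i s using that by (auto simp: J_def)
    have "left_ideal S J"
      unfolding left_ideal_def
    proof (intro conjI ballI)
      show "J \<subseteq> S" using IS D x by (auto simp: J_def)
      show "0 \<in> J" using JI[OF I0 D(2)] by simp
      fix u assume "u \<in> J"
      then obtain i s where u: "u = i + s * x" "i \<in> I" "s \<in> S" by (auto simp: J_def)
      show "u + v \<in> J" if "v \<in> J" for v
      proof -
        obtain j t where v: "v = j + t * x" "j \<in> I" "t \<in> S" using \<open>v \<in> J\<close> by (auto simp: J_def)
        show ?thesis using JI[OF Ia[OF u(2) v(2)] D(6)[OF u(3) v(3)]] u v by (simp add: algebra_simps)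
      qed
      show "t * u \<in> J" if "t \<in> S" for t
        using JI[OF Im[OF that u(2)] D(4)[OF that u(3)]] u by (simp add: algebra_simps)
    qed
    moreover have "I \<subseteq> J" using JI[OF _ D(2)] by auto
    moreover have "x \<in> J" using JI[OF I0 D(1)] by simp
    ultimately have "J = S" using I xI unfolding maximal_left_ideal_def by blast
    then have "1 \<in> J" using D(1) by simp
    then obtain i s where i: "1 = i + s * x" "i \<in> I" "s \<in> S" unfolding J_def by blast
    then have "1 - s * x \<in> I" by (metis add_diff_cancel_right')
    moreover obtain z where "z \<in> S" "z * (1 - s * x) = 1" using x i(3) by blast
    ultimately have "1 \<in> I" using Im by metis
    then show False using left_ideal_eq_iff_one[OF li S] ne by simp
  qed
  then show "x \<in> Rad S" using x by (simp add: Rad_def)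
qed

lemma Rad_zero: "0 \<in> S \<Longrightarrow> 0 \<in> Rad S"
  by (auto simp: Rad_def maximal_left_ideal_def left_ideal_def)

lemma Rad_UNIV_iff:
  "x \<in> Rad (UNIV :: 'a::complex_banach_algebra set) \<longleftrightarrow> (\<forall>y. 1 - x * y \<in> invertibles)"
proof -
  have US: "unital_subring (UNIV :: 'a set)" by (simp add: unital_subring_def)
  have L: "(\<forall>y. 1 - y * x \<in> invertibles) \<longleftrightarrow> (\<forall>y. \<exists>z. z * (1 - y * x) = 1)"
  proof
    assume "\<forall>y. 1 - y * x \<in> invertibles"
    then show "\<forall>y. \<exists>z. z * (1 - y * x) = 1" using ainv_left by blast
  next
    assume L: "\<forall>y. \<exists>z. z * (1 - y * x) = 1"
    show "\<forall>y. 1 - y * x \<in> invertibles"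
    proof
      fix y
      obtain z where z: "z * (1 - y * x) = 1" using L by blast
      \<comment> \<open>The left inverse \<open>z\<close> is itself \<open>1 - (- z y) x\<close>, so it has a left inverse too.\<close>
      have "1 - (- (z * y)) * x = z * (1 - y * x) + z * y * x" by (simp add: z)
      also have "\<dots> = z" by (simp add: algebra_simps)
      finally have "z = 1 - (- (z * y)) * x" by (rule sym)
      then obtain w where w: "w * z = 1" using L by metis
      have "w = w * (z * (1 - y * x))" by (simp add: z)
      also have "\<dots> = 1 - y * x" by (simp add: w flip: mult.assoc)
      finally have "w = 1 - y * x" .
      with w z show "1 - y * x \<in> invertibles" by (intro invertiblesI[of _ z]) simp_all
    qed
  qed
  have "x \<in> Rad UNIV \<longleftrightarrow> (\<forall>y. \<exists>z. z * (1 - y * x) = 1)"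
    by (simp only: Rad_iff_left_invertible[OF US] bex_UNIV ball_UNIV UNIV_I simp_thms)
  also have "\<dots> \<longleftrightarrow> (\<forall>y. 1 - y * x \<in> invertibles)"
    by (rule L[symmetric])
  also have "\<dots> \<longleftrightarrow> (\<forall>y. 1 - x * y \<in> invertibles)"
    by (intro iff_allI one_minus_mult_invertible_commute)
  finally show ?thesis .
qed

section \<open>Compactness of the spectrum\<close>

lemma norm_one_ge_one: "1 \<le> norm (1::'a::complex_banach_algebra)"
  using norm_mult_ineq[of "1::'a" 1] by simp

lemma norm_power_le:
  fixes x :: "'a::complex_banach_algebra"
  assumes "0 < n"
  shows "norm (x ^ n) \<le> norm x ^ n"
  using assms
proof (induction n rule: nat_induct_non_zero)
  case (Suc n)
  have "norm (x ^ Suc n) \<le> norm x * norm (x ^ n)"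
    using norm_mult_ineq by simp
  also have "\<dots> \<le> norm x * norm x ^ n"
    using Suc by (intro mult_left_mono) auto
  finally show ?case by simp
qed simp

lemma norm_less_one_invertible:
  fixes x :: "'a::complex_banach_algebra"
  assumes "norm x < 1"
  shows "1 - x \<in> invertibles"
proof (rule invertiblesI)
  have s: "summable (\<lambda>n. x ^ n)"
  proof (rule summable_comparison_test')
    show "summable (\<lambda>n. norm x ^ n)"
      using assms by (intro summable_geometric) simp
    show "norm (x ^ n) \<le> norm x ^ n" if "n \<ge> 1" for n
      using that by (intro norm_power_le) simp
  qed
  have h: "(\<Sum>n. x ^ Suc n) = (\<Sum>n. x ^ n) - 1"
    using suminf_split_head[OF s] by simp
  have "x * (\<Sum>n. x ^ n) = (\<Sum>n. x ^ n) - 1"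
    using suminf_mult[OF s, of x] h by simp
  then show "(1 - x) * (\<Sum>n. x ^ n) = 1"
    by (simp add: algebra_simps)
  have "(\<Sum>n. x ^ n) * x = (\<Sum>n. x ^ n) - 1"
    using suminf_mult2[OF s, of x] h by (simp flip: power_Suc2)
  then show "(\<Sum>n. x ^ n) * (1 - x) = 1"
    by (simp add: algebra_simps)
qed

lemma near_invertible:
  assumes "x \<in> invertibles" "norm (ainv x) * norm (y - x) < 1"
  shows "y \<in> invertibles"
proof -
  have "norm (ainv x * (x - y)) < 1"
    using norm_mult_ineq[of "ainv x" "x - y"] assms(2) by (simp add: norm_minus_commute)
  then have "x * (1 - ainv x * (x - y)) \<in> invertibles"
    using assms(1) by (intro mult_invertible norm_less_one_invertible)
  then show ?thesis
    using assms(1) by (simp add: right_diff_distrib ainv_cancel_left)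
qed

lemma bounded_linear_scaleC: "bounded_linear (\<lambda>z. z *\<^sub>C (x::'a::complex_banach_algebra))"
proof (rule bounded_linear_intro[of _ "norm x"])
  show "(r *\<^sub>R z) *\<^sub>C x = r *\<^sub>R z *\<^sub>C x" for r z
    by (simp only: scaleR_scaleC[of r "z *\<^sub>C x"] scaleC_scaleC scaleR_conv_of_real[of r z])
qed (simp_all add: scaleC_add_left norm_scaleC)

text \<open>
  The resolvent identity \<open>y\<inverse> - x\<inverse> = y\<inverse> (x - y) x\<inverse>\<close> first bounds \<open>y\<inverse>\<close> near \<open>x\<close> and then makes the
  difference small.
\<close>

lemma continuous_ainv:
  "continuous_on invertibles (ainv :: 'a::complex_banach_algebra \<Rightarrow> 'a)"
  unfolding continuous_on_iff
proof (intro ballI allI impI)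
  fix x :: 'a and e :: real
  assume x: "x \<in> invertibles" and e: "0 < e"
  define c where "c = norm (ainv x) + 1"
  have c: "c > 0" "norm (ainv x) \<le> c" by (auto simp: c_def add_pos_nonneg add.commute)
  define \<delta> where "\<delta> = min (1 / (2 * c)) (e / (2 * c * c))"
  have "\<delta> > 0" using c e by (simp add: \<delta>_def)
  moreover have "dist (ainv y) (ainv x) < e" if y: "y \<in> invertibles" "dist y x < \<delta>" for y
  proof -
    have "ainv y - ainv x = ainv y * (x * ainv x) - (ainv y * y) * ainv x"
      by (simp only: ainv_right[OF x] ainv_left[OF y(1)] mult_1_left mult_1_right)
    also have "\<dots> = ainv y * (x - y) * ainv x"
      by (simp add: algebra_simps)
    finally have "ainv y - ainv x = ainv y * (x - y) * ainv x" .
    then have n: "norm (ainv y - ainv x) \<le> norm (ainv y) * norm (y - x) * norm (ainv x)"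
      using order_trans[OF norm_mult_ineq mult_right_mono[OF norm_mult_ineq norm_ge_zero]]
      by (simp add: norm_minus_commute[of y])
    also have "\<dots> \<le> norm (ainv y) * (1 / (2 * c)) * c"
      using y(2) c by (intro mult_mono) (auto simp: \<delta>_def dist_norm)
    finally have "norm (ainv y) - norm (ainv x) \<le> norm (ainv y) / 2"
      using c norm_triangle_ineq2[of "ainv y" "ainv x"] by simp
    then have b: "norm (ainv y) \<le> 2 * c" using c(2) by simp
    have "norm (ainv y) * norm (y - x) * norm (ainv x) \<le> 2 * c * norm (y - x) * c"
      using b c by (intro mult_mono) auto
    also have "\<dots> < 2 * c * (e / (2 * c * c)) * c"
      using y(2) c(1) by (intro mult_strict_right_mono mult_strict_left_mono) (auto simp: \<delta>_def dist_norm)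
    also have "\<dots> = e" using c(1) by simp
    finally show ?thesis using n by (simp add: dist_norm)
  qed
  ultimately show "\<exists>d>0. \<forall>y\<in>invertibles. dist y x < d \<longrightarrow> dist (ainv y) (ainv x) < e"
    by blast
qed

lemma spectrum_iff: "z \<in> spectrum x \<longleftrightarrow> z *\<^sub>C 1 - x \<notin> invertibles"
  by (simp add: spectrum_def)

lemma spectrum_iff_nonzero:
  assumes "z \<noteq> 0"
  shows "z \<in> spectrum x \<longleftrightarrow> 1 - (1 / z) *\<^sub>C x \<notin> invertibles"
proof -
  have "z *\<^sub>C 1 - x = z *\<^sub>C (1 - (1 / z) *\<^sub>C x)"
    using assms by (simp add: scaleC_simps)
  then show ?thesis using scaleC_invertible[OF assms] by (simp add: spectrum_iff)
qed

lemma zero_in_spectrum_iff: "0 \<in> spectrum x \<longleftrightarrow> x \<notin> invertibles"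
  by (simp add: spectrum_iff minus_invertible)

lemma one_in_spectrum_iff: "1 \<in> spectrum x \<longleftrightarrow> 1 - x \<notin> invertibles"
  by (simp add: spectrum_iff scaleC_one)

lemma spectrum_scaleC_iff:
  assumes "c \<noteq> 0"
  shows "z \<in> spectrum (c *\<^sub>C x) \<longleftrightarrow> z / c \<in> spectrum x"
proof -
  have "z *\<^sub>C 1 - c *\<^sub>C x = c *\<^sub>C ((z / c) *\<^sub>C 1 - x)"
    using assms by (simp add: scaleC_simps)
  then show ?thesis using scaleC_invertible[OF assms] by (simp add: spectrum_iff)
qed

lemma spectrum_scalar: "spectrum (c *\<^sub>C (1::'a::complex_banach_algebra)) = {c}"
proof -
  have "z \<in> spectrum (c *\<^sub>C (1::'a)) \<longleftrightarrow> z - c = 0" for z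
  proof -
    have "z *\<^sub>C 1 - c *\<^sub>C (1::'a) = (z - c) *\<^sub>C 1" by (simp add: scaleC_simps)
    then show ?thesis
      using scaleC_invertible[of "z - c" "1::'a"] zero_not_invertible one_invertible
      by (cases "z - c = 0") (auto simp: spectrum_iff)
  qed
  then show ?thesis by auto
qed

lemma spectrum_zero: "spectrum (0::'a::complex_banach_algebra) = {0}"
  using spectrum_scalar[of 0] by simp

lemma spectrum_norm_bound:
  assumes "z \<in> spectrum x"
  shows "cmod z \<le> norm x"
proof (rule ccontr)
  assume *: "\<not> ?thesis"
  then have "z \<noteq> 0" by auto
  have "norm ((1 / z) *\<^sub>C x) < 1"
    using * \<open>z \<noteq> 0\<close> by (simp add: norm_scaleC norm_divide divide_simps)
  then show False
    using norm_less_one_invertible assms spectrum_iff_nonzero[OF \<open>z \<noteq> 0\<close>] by blast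
qed

lemma compact_spectrum: "compact (spectrum (x::'a::complex_banach_algebra))"
proof -
  have "open (invertibles :: 'a set)"
    unfolding open_dist
  proof
    fix x :: 'a assume x: "x \<in> invertibles"
    have "y \<in> invertibles" if "dist y x < 1 / (norm (ainv x) + 1)" for y
    proof (rule near_invertible[OF x])
      have "norm (y - x) * (norm (ainv x) + 1) < 1"
        using that by (simp add: dist_norm field_simps add_pos_nonneg)
      then show "norm (ainv x) * norm (y - x) < 1"
        by (simp add: algebra_simps) (smt (verit) norm_ge_zero)
    qed
    then show "\<exists>e>0. \<forall>y. dist y x < e \<longrightarrow> y \<in> invertibles"
      by (intro exI[of _ "1 / (norm (ainv x) + 1)"]) (auto simp: add_nonneg_pos)
  qed
  moreover have "continuous_on UNIV (\<lambda>z. z *\<^sub>C 1 - x)"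
    by (intro continuous_intros bounded_linear.continuous_on[OF bounded_linear_scaleC])
  ultimately have "open ((\<lambda>z. z *\<^sub>C 1 - x) -` invertibles)"
    by (rule open_vimage)
  moreover have "spectrum x = - ((\<lambda>z. z *\<^sub>C 1 - x) -` invertibles)"
    by (auto simp: spectrum_def)
  ultimately have "closed (spectrum x)" by auto
  moreover have "bounded (spectrum x)"
    using spectrum_norm_bound by (intro boundedI) auto
  ultimately show ?thesis by (simp add: compact_eq_bounded_closed)
qed

lemma spectrum_attains_max_modulus:
  assumes "spectrum x \<noteq> {}"
  obtains z where "z \<in> spectrum x" "\<And>w. w \<in> spectrum x \<Longrightarrow> cmod w \<le> cmod z"
  using continuous_attains_sup[OF compact_spectrum assms, of cmod]
  by (metis continuous_on_norm_id)

section \<open>Elements are determined by the spectra of their multiples\<close>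

lemma diff_invertible_iff_spectrum:
  assumes "v \<in> invertibles"
  shows "a - v \<in> invertibles \<longleftrightarrow> 1 \<notin> spectrum (a * ainv v)"
proof -
  have "a - v = - ((1 - a * ainv v) * v)"
    using assms by (simp add: left_diff_distrib mult.assoc ainv_left)
  then show ?thesis
    using mult_invertible_cancel_right[OF assms] by (simp add: one_in_spectrum_iff minus_invertible)
qed

text \<open>
  Let \<open>d = a - b\<close>, and suppose that \<open>1 - d\<close> is singular although no point of the spectrum of \<open>d\<close> exceeds
  one in modulus. Take \<open>k > norm a\<close> and walk along \<open>v i = (1 + k) - i d\<close>. For \<open>i \<le> k\<close> the element \<open>v i\<close> is
  invertible, since \<open>i = 0\<close> or \<open>(1 + k) / i > 1\<close>, and so the hypothesis says that \<open>a - v i\<close> and \<open>b - v i\<close> are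
  invertible together. Moreover \<open>b - v (i + 1) = a - v i\<close>. The walk starts at \<open>a - v 0 = a - (1 + k)\<close>,
  which is invertible by the choice of \<open>k\<close>, and so \<open>a - v k = b - v (k + 1)\<close> is invertible. With \<open>x\<close> its
  inverse, \<open>a x - 1 = v k x\<close> is invertible, hence also \<open>b x - 1 = v (k + 1) x\<close>. But \<open>v (k + 1)\<close> is a multiple of \<open>1 - d\<close>.
\<close>

lemma one_not_in_spectrum_difference:
  fixes a b :: "'a::complex_banach_algebra"
  assumes eq: "\<And>x. spectrum (a * x) = spectrum (b * x)"
    and le: "\<And>z. z \<in> spectrum (a - b) \<Longrightarrow> cmod z \<le> 1"
  shows "1 \<notin> spectrum (a - b)"
proof
  assume 1: "1 \<in> spectrum (a - b)"
  define d where "d = a - b"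
  obtain k :: nat where k: "norm a < real k"
    using reals_Archimedean2 by blast
  define c :: complex where "c = of_nat (Suc k)"
  have c: "c \<noteq> 0" "cmod c = real (Suc k)"
    by (simp_all add: c_def del: of_nat_Suc)
  define v where "v i = c *\<^sub>C 1 - of_nat i *\<^sub>C d" for i :: nat
  have step: "a - v i = b - v (Suc i)" for i
    by (simp add: v_def d_def scaleC_simps algebra_simps)
  have inv: "v i \<in> invertibles" if "i \<le> k" for i
  proof (cases "i = 0")
    case True
    then show ?thesis
      using scaleC_invertible[OF c(1), of "1::'a"] one_invertible by (simp add: v_def)
  next
    case False
    let ?z = "c / of_nat i"
    have "v i = of_nat i *\<^sub>C (?z *\<^sub>C 1 - d)"
      using False by (simp add: v_def scaleC_simps)
    moreover have "cmod ?z > 1"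
      using that False by (simp add: norm_divide c(2) divide_simps)
    then have "?z \<notin> spectrum d" using le[of ?z] unfolding d_def by linarith
    ultimately show ?thesis
      using scaleC_invertible[of "of_nat i" "?z *\<^sub>C 1 - d"] False by (simp add: spectrum_iff)
  qed
  have "a - v i \<in> invertibles" if "i \<le> k" for i
    using that
  proof (induction i)
    case 0
    have "c \<notin> spectrum a"
      using spectrum_norm_bound[of c a] k c(2) by auto
    then show ?case
      using diff_invertible_commute[of a] by (simp add: spectrum_iff v_def)
  next
    case (Suc i)
    then have "b - v (Suc i) \<in> invertibles" by (simp flip: step)
    then show ?case
      using diff_invertible_iff_spectrum[OF inv[OF Suc.prems]] eq by simp
  qed
  then have u: "a - v k \<in> invertibles" by simp
  let ?x = "ainv (a - v k)"
  have "1 - a * ?x = - (v k * ?x)"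
    using ainv_right[OF u] by (simp add: algebra_simps)
  then have "1 \<notin> spectrum (a * ?x)"
    using u inv[of k] by (simp add: one_in_spectrum_iff minus_invertible mult_invertible ainv_invertible)
  then have "1 - b * ?x \<in> invertibles"
    by (simp add: eq one_in_spectrum_iff)
  moreover have "1 - b * ?x = - (v (Suc k) * ?x)"
    using ainv_right[OF u] by (simp add: step algebra_simps)
  ultimately have "v (Suc k) \<in> invertibles"
    using ainv_invertible[OF u] by (simp add: minus_invertible mult_invertible_cancel_right)
  moreover have "v (Suc k) = c *\<^sub>C (1 - d)"
    by (simp add: v_def scaleC_diff_right del: of_nat_Suc flip: c_def)
  ultimately have "1 - d \<in> invertibles"
    using scaleC_invertible[OF c(1), of "1 - d"] by simp
  then show False using 1 by (simp add: d_def one_in_spectrum_iff)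
qed

text \<open>
  The spectrum of \<open>a - b\<close> is compact; a nonzero point of maximal modulus can be scaled to one.
\<close>

lemma spectrum_difference_subset:
  fixes a b :: "'a::complex_banach_algebra"
  assumes eq: "\<And>x. spectrum (a * x) = spectrum (b * x)"
  shows "spectrum (a - b) \<subseteq> {0}"
proof (rule ccontr)
  assume *: "\<not> ?thesis"
  then obtain z where z: "z \<in> spectrum (a - b)"
    and max: "\<And>w. w \<in> spectrum (a - b) \<Longrightarrow> cmod w \<le> cmod z"
    using spectrum_attains_max_modulus[of "a - b"] by blast
  have "z \<noteq> 0" using * max by fastforce
  let ?a = "(1 / z) *\<^sub>C a" and ?b = "(1 / z) *\<^sub>C b"
  have d: "?a - ?b = (1 / z) *\<^sub>C (a - b)" by (simp add: scaleC_simps)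
  have "spectrum (?a * x) = spectrum (?b * x)" for x
    using eq[of "(1 / z) *\<^sub>C x"] by (simp add: scaleC_simps)
  moreover have "cmod w \<le> 1" if "w \<in> spectrum (?a - ?b)" for w
    using max[of "w * z"] that \<open>z \<noteq> 0\<close> unfolding d
    by (simp add: spectrum_scaleC_iff norm_mult)
  ultimately have "1 \<notin> spectrum (?a - ?b)"
    by (rule one_not_in_spectrum_difference)
  then show False
    using z \<open>z \<noteq> 0\<close> unfolding d by (simp add: spectrum_scaleC_iff)
qed

text \<open>
  The hypothesis passes from \<open>a\<close> and \<open>b\<close> to \<open>a y\<close> and \<open>b y\<close>, so that every multiple of \<open>a - b\<close> is
  quasinilpotent.
\<close>

theorem difference_in_Rad:
  fixes a b :: "'a::complex_banach_algebra"
  assumes eq: "\<And>x. spectrum (a * x) = spectrum (b * x)"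
  shows "a - b \<in> Rad UNIV"
  unfolding Rad_UNIV_iff
proof
  fix y
  have "spectrum (a * y * x) = spectrum (b * y * x)" for x
    using eq[of "y * x"] by (simp add: mult.assoc)
  from spectrum_difference_subset[OF this] have "1 \<notin> spectrum ((a - b) * y)"
    by (auto simp: left_diff_distrib)
  then show "1 - (a - b) * y \<in> invertibles" by (simp add: one_in_spectrum_iff)
qed

section \<open>The spectral radius\<close>

text \<open>
  Powers of two suffice, and they fit the averaging argument below, which squares at each step.
\<close>

definition power_contractive :: "'a::complex_banach_algebra \<Rightarrow> bool" where
  "power_contractive x \<longleftrightarrow> (\<exists>n. norm (x ^ 2 ^ n) < 1)"

lemma power_contractive_small:
  fixes x :: "'a::complex_banach_algebra"
  assumes "power_contractive x" "0 < e"
  obtains n where "norm (x ^ 2 ^ n) < e"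
proof -
  obtain n where n: "norm (x ^ 2 ^ n) < 1"
    using assms by (auto simp: power_contractive_def)
  obtain k where k: "norm (x ^ 2 ^ n) ^ k < e"
    using real_arch_pow_inv[OF assms(2) n] by blast
  have "norm (x ^ 2 ^ (n + k)) = norm ((x ^ 2 ^ n) ^ 2 ^ k)"
    by (simp add: power_add flip: power_mult)
  also have "\<dots> \<le> norm (x ^ 2 ^ n) ^ 2 ^ k"
    by (rule norm_power_le) simp
  also have "\<dots> \<le> norm (x ^ 2 ^ n) ^ k"
    using n less_exp[of k] by (intro power_decreasing) auto
  finally have "norm (x ^ 2 ^ (n + k)) < e" using k by simp
  then show thesis by (rule that)
qed

lemma one_minus_power_factor:
  fixes x :: "'a::complex_banach_algebra"
  shows "(1 - x) * (\<Sum>i<n. x ^ i) = 1 - x ^ n" "(\<Sum>i<n. x ^ i) * (1 - x) = 1 - x ^ n"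
proof -
  show "(1 - x) * (\<Sum>i<n. x ^ i) = 1 - x ^ n"
  proof (induction n)
    case (Suc n)
    then show ?case by (simp add: distrib_left) (simp add: left_diff_distrib)
  qed simp
  show "(\<Sum>i<n. x ^ i) * (1 - x) = 1 - x ^ n"
  proof (induction n)
    case (Suc n)
    then show ?case by (simp add: distrib_right) (simp add: right_diff_distrib power_commutes)
  qed simp
qed

lemma one_minus_invertible_of_power:
  fixes x :: "'a::complex_banach_algebra"
  assumes "norm (x ^ n) < 1"
  shows "1 - x \<in> invertibles"
  using norm_less_one_invertible[OF assms] one_minus_power_factor[of x n]
  by (metis commuting_factor_invertible)

text \<open>
  This is the partial fraction decomposition of \<open>1 / (1 - y\<^sup>2)\<close>.
\<close>

lemma ainv_one_minus_square:
  fixes y :: "'a::complex_banach_algebra"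
  assumes "1 - y \<in> invertibles" "1 + y \<in> invertibles"
  shows "ainv (1 - y * y) = (1 / 2) *\<^sub>C (ainv (1 - y) + ainv (1 + y))"
proof (rule ainv_unique)
  have f: "1 - y * y = (1 + y) * (1 - y)" "1 - y * y = (1 - y) * (1 + y)"
    by (simp_all add: algebra_simps)
  have two: "(1 / 2 :: complex) *\<^sub>C ((1 + y) + (1 - y)) = 1"
  proof -
    have "(1 + y) + (1 - y) = 1 *\<^sub>C 1 + 1 *\<^sub>C 1" by (simp add: scaleC_one)
    also have "\<dots> = (1 + 1) *\<^sub>C 1" by (simp only: scaleC_add_left)
    finally show ?thesis by (simp only: scaleC_scaleC) (simp add: scaleC_one)
  qed
  have "(1 - y * y) * ainv (1 - y) = 1 + y"
    unfolding f(1) using ainv_right[OF assms(1)] by (simp add: mult.assoc)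
  moreover have "(1 - y * y) * ainv (1 + y) = 1 - y"
    unfolding f(2) using ainv_right[OF assms(2)] by (simp add: mult.assoc)
  ultimately show "(1 - y * y) * (1 / 2) *\<^sub>C (ainv (1 - y) + ainv (1 + y)) = 1"
    by (simp only: mult_scaleC_right distrib_left two)
  have "ainv (1 - y) * (1 - y * y) = 1 + y"
    unfolding f(2) using ainv_left[OF assms(1)] by (simp flip: mult.assoc)
  moreover have "ainv (1 + y) * (1 - y * y) = 1 - y"
    unfolding f(1) using ainv_left[OF assms(2)] by (simp flip: mult.assoc)
  ultimately show "(1 / 2) *\<^sub>C (ainv (1 - y) + ainv (1 + y)) * (1 - y * y) = 1"
    by (simp only: mult_scaleC_left distrib_right two)
qed

text \<open>
  Let \<open>R n z\<close> be the inverse of \<open>1 - (z x)\<^sup>N\<close> with \<open>N = 2 ^ n\<close>. By partial fractions, \<open>R (n + 1) z\<close> is the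
  mean of \<open>R n z\<close> and \<open>R n (\<omega> z)\<close> with \<open>\<omega>\<^sup>N = - 1\<close>, so all \<open>R n\<close> inherit the modulus of continuity of \<open>R 0\<close>
  on the closed unit disc. If some power \<open>(t x)\<^sup>N\<close> is small, then \<open>R n t\<close> is close to one; by
  equicontinuity \<open>R n s\<close> is close to one for \<open>s = t + 1 / K\<close> with \<open>K\<close> independent of \<open>n\<close>, and so the norm
  of \<open>(s x)\<^sup>N\<close> is less than one. Finitely many such steps lead from \<open>t = 0\<close> to \<open>t = 1\<close>. This averaging replaces
  Cauchy's integral formula and the Hahn-Banach theorem in the usual proof of the spectral radius formula.
\<close>

theorem power_contractive_of_resolvent:
  fixes x :: "'a::complex_banach_algebra"
  assumes inv: "\<And>z. cmod z \<le> 1 \<Longrightarrow> 1 - z *\<^sub>C x \<in> invertibles"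
  shows "power_contractive x"
proof -
  define R where "R n z = ainv (1 - (z *\<^sub>C x) ^ 2 ^ n)" for n :: nat and z
  define \<omega> where "\<omega> n = cis (pi / 2 ^ n)" for n :: nat
  have \<omega>: "\<omega> n ^ 2 ^ n = -1" "cmod (\<omega> n) = 1" for n
  proof -
    have "\<omega> n ^ 2 ^ n = cis (real (2 ^ n) * (pi / 2 ^ n))"
      unfolding \<omega>_def by (rule Complex.DeMoivre)
    then show "\<omega> n ^ 2 ^ n = -1" by simp
    show "cmod (\<omega> n) = 1" by (simp add: \<omega>_def)
  qed
  have rot: "1 + (z *\<^sub>C x) ^ 2 ^ n = 1 - ((\<omega> n * z) *\<^sub>C x) ^ 2 ^ n" for n z
    by (simp add: scaleC_power power_mult_distrib \<omega> scaleC_minus_left)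
  have sq: "w ^ 2 ^ Suc n = w ^ 2 ^ n * w ^ 2 ^ n" for w :: 'a and n
    by (simp add: mult_2 power_add)
  have Rinv: "1 - (z *\<^sub>C x) ^ 2 ^ n \<in> invertibles" if "cmod z \<le> 1" for n z
    using that
  proof (induction n arbitrary: z)
    case 0
    then show ?case using inv by simp
  next
    case (Suc n)
    let ?y = "(z *\<^sub>C x) ^ 2 ^ n"
    have "1 - ?y \<in> invertibles" "1 + ?y \<in> invertibles"
      using Suc.IH[of z] Suc.IH[of "\<omega> n * z"] Suc.prems by (simp_all add: rot norm_mult \<omega>)
    moreover have "1 - (z *\<^sub>C x) ^ 2 ^ Suc n = (1 - ?y) * (1 + ?y)"
      unfolding sq by (simp add: algebra_simps)
    ultimately show ?case using mult_invertible by simp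
  qed
  have Rhalf: "R (Suc n) z = (1 / 2) *\<^sub>C (R n z + R n (\<omega> n * z))" if "cmod z \<le> 1" for n z
  proof -
    have "1 + (z *\<^sub>C x) ^ 2 ^ n \<in> invertibles"
      unfolding rot using that by (intro Rinv) (simp add: norm_mult \<omega>)
    then show ?thesis
      using ainv_one_minus_square[OF Rinv[OF that, of n]] by (simp only: R_def sq rot)
  qed
  have "continuous_on (cball 0 1) (\<lambda>z. ainv (1 - z *\<^sub>C x))"
    using inv
    by (intro continuous_on_compose2[OF continuous_ainv] continuous_intros
        bounded_linear.continuous_on[OF bounded_linear_scaleC]) auto
  then have "uniformly_continuous_on (cball 0 1) (\<lambda>z. ainv (1 - z *\<^sub>C x))"
    by (intro compact_uniformly_continuous) auto
  then obtain \<delta> where \<delta>: "\<delta> > 0"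
    "\<And>z w. cmod z \<le> 1 \<Longrightarrow> cmod w \<le> 1 \<Longrightarrow> cmod (z - w) < \<delta> \<Longrightarrow> norm (R 0 z - R 0 w) < 1 / 8"
    unfolding uniformly_continuous_on_def R_def dist_norm
    by (auto dest!: spec[of _ "1 / 8"])
  have equi: "norm (R n z - R n w) < 1 / 8" if "cmod z \<le> 1" "cmod w \<le> 1" "cmod (z - w) < \<delta>" for n z w
    using that
  proof (induction n arbitrary: z w)
    case 0
    then show ?case by (rule \<delta>(2))
  next
    case (Suc n)
    have "norm (R n z - R n w) < 1 / 8"
      using Suc by blast
    moreover have "norm (R n (\<omega> n * z) - R n (\<omega> n * w)) < 1 / 8"
      using Suc.prems by (intro Suc.IH) (simp_all add: norm_mult \<omega> flip: right_diff_distrib)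
    moreover have "R (Suc n) z - R (Suc n) w
        = (1 / 2) *\<^sub>C ((R n z - R n w) + (R n (\<omega> n * z) - R n (\<omega> n * w)))"
      using Suc.prems by (simp add: Rhalf scaleC_simps algebra_simps)
    ultimately show ?case
      using norm_triangle_ineq[of "R n z - R n w" "R n (\<omega> n * z) - R n (\<omega> n * w)"]
      by (simp add: norm_scaleC)
  qed
  obtain K where K: "1 / real (Suc K) < \<delta>"
    using \<delta>(1) reals_Archimedean by (auto simp: inverse_eq_divide)
  have "power_contractive (complex_of_real (real j / real (Suc K)) *\<^sub>C x)" if "j \<le> Suc K" for j
    using that
  proof (induction j)
    case 0
    then show ?case by (auto simp: power_contractive_def power_0_left)
  next
    case (Suc j)
    let ?t = "complex_of_real (real j / real (Suc K))"
    let ?s = "complex_of_real (real (Suc j) / real (Suc K))"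
    have t1: "cmod ?t \<le> 1" and s1: "cmod ?s \<le> 1"
      using Suc.prems by (simp_all only: norm_of_real) (simp_all add: divide_simps)
    have "?s - ?t = complex_of_real (1 / real (Suc K))"
      by (simp only: flip: of_real_diff diff_divide_distrib) simp
    then have st: "cmod (?s - ?t) < \<delta>" using K by (simp only: norm_of_real) simp
    obtain n where n: "norm ((?t *\<^sub>C x) ^ 2 ^ n) < 1 / 5"
      using power_contractive_small[of "?t *\<^sub>C x" "1 / 5"] Suc by auto
    let ?y = "(?t *\<^sub>C x) ^ 2 ^ n" and ?w = "(?s *\<^sub>C x) ^ 2 ^ n"
    \<comment> \<open>For \<open>F = (1 - y)\<inverse>\<close> the relation \<open>(1 - y) F = 1\<close> bounds \<open>F - 1\<close> in terms of \<open>y\<close>.\<close>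
    have y: "R n ?t - 1 = ?y + ?y * (R n ?t - 1)"
      using ainv_right[OF Rinv[OF t1, of n]] by (simp add: R_def algebra_simps)
    have "norm (R n ?t - 1) \<le> norm ?y + norm ?y * norm (R n ?t - 1)"
      by (subst y) (metis add_left_mono norm_mult_ineq norm_triangle_le)
    also have "\<dots> \<le> 1 / 5 + 1 / 5 * norm (R n ?t - 1)"
      using n by (intro add_mono mult_right_mono) auto
    finally have "norm (R n ?t - 1) \<le> 1 / 4" by simp
    moreover have "norm (R n ?s - R n ?t) < 1 / 8"
      using equi[OF s1 t1 st] .
    ultimately have s: "norm (R n ?s - 1) < 3 / 8"
      using norm_triangle_ineq[of "R n ?s - R n ?t" "R n ?t - 1"] by simp
    \<comment> \<open>Conversely, \<open>F (1 - w) = 1\<close> bounds \<open>w\<close> in terms of \<open>F - 1\<close>.\<close>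
    have w: "?w = (R n ?s - 1) - (R n ?s - 1) * ?w"
      using ainv_left[OF Rinv[OF s1, of n]] by (simp add: R_def algebra_simps)
    have "norm ?w \<le> norm (R n ?s - 1) + norm (R n ?s - 1) * norm ?w"
      by (subst w) (metis add_left_mono norm_mult_ineq norm_triangle_le_diff)
    also have "\<dots> \<le> 3 / 8 + 3 / 8 * norm ?w"
      using s by (intro add_mono mult_right_mono) auto
    finally have "norm ?w < 1" by simp
    then show ?case unfolding power_contractive_def by blast
  qed
  from this[of "Suc K"] show ?thesis by (simp add: scaleC_one)
qed

lemma power_contractive_of_spectrum:
  fixes x :: "'a::complex_banach_algebra"
  assumes "\<And>z. z \<in> spectrum x \<Longrightarrow> cmod z < 1"
  shows "power_contractive x"
proof (rule power_contractive_of_resolvent)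
  fix z :: complex assume z: "cmod z \<le> 1"
  show "1 - z *\<^sub>C x \<in> invertibles"
  proof (cases "z = 0")
    case True
    then show ?thesis by (simp add: one_invertible)
  next
    case False
    have "\<not> cmod (1 / z) < 1"
      using z False by (simp add: norm_divide)
    then have "1 / z \<notin> spectrum x" using assms by blast
    then show ?thesis using spectrum_iff_nonzero[of "1 / z" x] False by simp
  qed
qed

text \<open>
  An empty spectrum would make \<open>c x\<close> power contractive for every \<open>c > 0\<close>, although the powers of an
  invertible element \<open>x\<close> decay at most geometrically.
\<close>

lemma spectrum_nonempty: "spectrum (x::'a::complex_banach_algebra) \<noteq> {}"
proof
  assume e: "spectrum x = {}"
  then have inv: "x \<in> invertibles" using zero_in_spectrum_iff[of x] by simp
  define c where "c = norm (ainv x) + 1"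
  have c: "0 < c" "norm (ainv x) \<le> c" by (auto simp: c_def add_nonneg_pos)
  have "power_contractive (complex_of_real c *\<^sub>C x)"
    using c e by (intro power_contractive_of_spectrum) (simp add: spectrum_scaleC_iff)
  then obtain n where "norm ((complex_of_real c *\<^sub>C x) ^ 2 ^ n) < 1"
    by (auto simp: power_contractive_def)
  then have n: "c ^ 2 ^ n * norm (x ^ 2 ^ n) < 1"
    using c by (simp add: scaleC_power norm_scaleC norm_power)
  have "ainv x ^ k * x ^ k = 1" for k
  proof (induction k)
    case (Suc k)
    have "ainv x ^ Suc k * x ^ Suc k = ainv x ^ k * (ainv x * x) * x ^ k"
      by (simp only: power_Suc2[of "ainv x"] power_Suc[of x] mult.assoc)
    then show ?case using Suc by (simp add: ainv_left[OF inv])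
  qed simp
  then have "norm (1::'a) \<le> norm (ainv x ^ 2 ^ n) * norm (x ^ 2 ^ n)"
    by (metis norm_mult_ineq)
  also have "\<dots> \<le> norm (ainv x) ^ 2 ^ n * norm (x ^ 2 ^ n)"
    by (intro mult_right_mono norm_power_le) auto
  also have "\<dots> \<le> c ^ 2 ^ n * norm (x ^ 2 ^ n)"
    using c by (intro mult_right_mono power_mono) auto
  finally show False using n norm_one_ge_one[where 'a='a] by simp
qed

definition spectral_radius :: "'a::complex_banach_algebra \<Rightarrow> real" where
  "spectral_radius x = Sup (cmod ` spectrum x)"

lemma spectral_radius_attained:
  obtains z where "z \<in> spectrum x" "cmod z = spectral_radius x"
proof -
  obtain z where "z \<in> spectrum x" "\<And>w. w \<in> spectrum x \<Longrightarrow> cmod w \<le> cmod z"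
    using spectrum_attains_max_modulus[OF spectrum_nonempty] by blast
  moreover from this have "spectral_radius x = cmod z"
    unfolding spectral_radius_def by (intro cSup_eq_maximum) auto
  ultimately show thesis using that by metis
qed

lemma spectrum_le_spectral_radius:
  assumes "z \<in> spectrum x"
  shows "cmod z \<le> spectral_radius x"
proof -
  obtain z' where "z' \<in> spectrum x" "\<And>w. w \<in> spectrum x \<Longrightarrow> cmod w \<le> cmod z'"
    using spectrum_attains_max_modulus[OF spectrum_nonempty] by blast
  then have "bdd_above (cmod ` spectrum x)" by (auto simp: bdd_above_def)
  then show ?thesis
    using assms by (auto simp: spectral_radius_def intro: cSup_upper)
qed

lemma spectral_radius_nonneg [simp]: "0 \<le> spectral_radius x"
  by (metis norm_ge_zero spectral_radius_attained)

lemma spectral_radius_le_zero_iff [simp]: "spectral_radius x \<le> 0 \<longleftrightarrow> spectral_radius x = 0"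
  using spectral_radius_nonneg[of x] by linarith

lemma spectral_radius_cong: "spectrum x = spectrum y \<Longrightarrow> spectral_radius x = spectral_radius y"
  by (simp add: spectral_radius_def)

lemma spectral_radius_scalar [simp]: "spectral_radius (c *\<^sub>C 1) = cmod c"
  by (simp add: spectral_radius_def spectrum_scalar)

lemma spectral_radius_zero [simp]: "spectral_radius 0 = 0"
  using spectral_radius_scalar[of 0] by simp

lemma spectral_radius_one [simp]: "spectral_radius 1 = 1"
  using spectral_radius_scalar[of 1] by (simp add: scaleC_one)

lemma spectral_radius_scaleC: "spectral_radius (c *\<^sub>C x) = cmod c * spectral_radius x"
proof (cases "c = 0")
  case False
  obtain z where z: "z \<in> spectrum x" "cmod z = spectral_radius x"
    by (rule spectral_radius_attained)
  obtain w where w: "w \<in> spectrum (c *\<^sub>C x)" "cmod w = spectral_radius (c *\<^sub>C x)"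
    by (rule spectral_radius_attained)
  have "cmod (c * z) \<le> spectral_radius (c *\<^sub>C x)"
    using z(1) False by (intro spectrum_le_spectral_radius) (simp add: spectrum_scaleC_iff)
  moreover have "cmod (w / c) \<le> spectral_radius x"
    using w(1) False by (intro spectrum_le_spectral_radius) (simp add: spectrum_scaleC_iff)
  ultimately show ?thesis
    using z(2) w(2) False by (simp add: norm_mult norm_divide divide_simps mult.commute)
qed simp

lemma spectral_radius_minus: "spectral_radius (- x) = spectral_radius x"
  using spectral_radius_scaleC[of "-1" x] by (simp add: scaleC_simps)

lemma spectral_radius_less_power:
  fixes x :: "'a::complex_banach_algebra"
  assumes "spectral_radius x < s"
  obtains n where "\<And>m. n \<le> m \<Longrightarrow> norm (x ^ 2 ^ m) < s ^ 2 ^ m"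
proof -
  have s: "0 < s" using assms spectral_radius_nonneg[of x] by linarith
  let ?y = "complex_of_real (1 / s) *\<^sub>C x"
  have "power_contractive ?y"
  proof (rule power_contractive_of_spectrum)
    fix z assume "z \<in> spectrum ?y"
    then have "cmod z \<le> spectral_radius ?y" by (rule spectrum_le_spectral_radius)
    also have "\<dots> < 1" using assms s by (simp add: spectral_radius_scaleC norm_divide)
    finally show "cmod z < 1" .
  qed
  then obtain n where n: "norm (?y ^ 2 ^ n) < 1"
    by (auto simp: power_contractive_def)
  have "norm (x ^ 2 ^ m) < s ^ 2 ^ m" if "n \<le> m" for m
  proof -
    have "?y ^ 2 ^ m = (?y ^ 2 ^ n) ^ 2 ^ (m - n)"
      using that by (simp flip: power_mult power_add)
    then have "norm (?y ^ 2 ^ m) \<le> norm (?y ^ 2 ^ n) ^ 2 ^ (m - n)"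
      by (simp only:) (rule norm_power_le, simp)
    also have "\<dots> < 1" using n by (intro power_less_one_iff[THEN iffD2]) auto
    finally show ?thesis
      using s by (simp add: scaleC_power norm_scaleC norm_power norm_divide divide_simps)
  qed
  then show thesis by (rule that)
qed

text \<open>
  Scale both factors by numbers slightly larger than their spectral radii: powers of the scaled factors have
  norm less than one, and because the factors commute, so does a power of the scaled product.
\<close>

lemma spectral_radius_mult:
  fixes x y :: "'a::complex_banach_algebra"
  assumes comm: "x * y = y * x"
  shows "spectral_radius (x * y) \<le> spectral_radius x * spectral_radius y"
proof (rule ccontr)
  assume less: "\<not> ?thesis"
  obtain z where z: "z \<in> spectrum (x * y)" "cmod z = spectral_radius (x * y)"
    by (rule spectral_radius_attained)
  let ?f = "\<lambda>e. (spectral_radius x + e) * (spectral_radius y + e)"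
  have "(?f \<longlongrightarrow> (spectral_radius x + 0) * (spectral_radius y + 0)) (at_right 0)"
    by (intro tendsto_intros)
  then have "eventually (\<lambda>e. ?f e < cmod z) (at_right 0)"
    by (rule order_tendstoD(2)) (use less z(2) in simp)
  then have "eventually (\<lambda>e. ?f e < cmod z \<and> 0 < e) (at_right (0::real))"
    using eventually_at_right_less[of "0::real"] by (rule eventually_conj)
  then obtain e where e: "?f e < cmod z" "0 < e"
    using eventually_happens[of _ "at_right (0::real)"] trivial_limit_at_right_real by blast
  let ?s = "spectral_radius x + e" and ?t = "spectral_radius y + e"
  have st: "0 < ?s" "0 < ?t"
    using e(2) spectral_radius_nonneg[of x] spectral_radius_nonneg[of y] by linarith+
  obtain n where n: "\<And>m. n \<le> m \<Longrightarrow> norm (x ^ 2 ^ m) < ?s ^ 2 ^ m"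
    using spectral_radius_less_power[of x ?s] e(2) by auto
  obtain k where k: "\<And>m. k \<le> m \<Longrightarrow> norm (y ^ 2 ^ m) < ?t ^ 2 ^ m"
    using spectral_radius_less_power[of y ?t] e(2) by auto
  let ?N = "2 ^ (n + k) :: nat"
  have pw: "(x * y) ^ m = x ^ m * y ^ m" for m
  proof (induction m)
    case (Suc m)
    have "x ^ m * y = y * x ^ m"
      by (rule power_commuting_commutes[OF comm])
    then have "x * (y * x ^ m) * y ^ m = x * (x ^ m * y) * y ^ m" by simp
    then show ?case using Suc by (simp add: mult.assoc)
  qed simp
  have "norm ((x * y) ^ ?N) \<le> norm (x ^ ?N) * norm (y ^ ?N)"
    unfolding pw by (rule norm_mult_ineq)
  also have "\<dots> < ?s ^ ?N * ?t ^ ?N"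
    using n[of "n + k"] k[of "n + k"] st by (intro mult_strict_mono) auto
  also have "\<dots> = ?f e ^ ?N" by (simp add: power_mult_distrib)
  also have "\<dots> \<le> cmod z ^ ?N"
    using e st by (intro power_mono) auto
  finally have N: "norm ((x * y) ^ ?N) < cmod z ^ ?N" .
  have "0 < ?f e" using st by simp
  then have z0: "z \<noteq> 0" using e(1) by auto
  have "norm (((1 / z) *\<^sub>C (x * y)) ^ ?N) < 1"
    using N z0 by (simp add: scaleC_power norm_scaleC norm_power norm_divide power_divide divide_simps)
  then have "1 - (1 / z) *\<^sub>C (x * y) \<in> invertibles"
    by (rule one_minus_invertible_of_power)
  then show False using z(1) spectrum_iff_nonzero[OF z0] by blast
qed

lemma spectrum_ainv:
  assumes "p \<in> invertibles" "v \<in> spectrum (ainv p)"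
  shows "v \<noteq> 0" "1 / v \<in> spectrum p"
proof -
  show v: "v \<noteq> 0"
    using assms ainv_invertible zero_in_spectrum_iff by blast
  have "v *\<^sub>C 1 - ainv p = - (v *\<^sub>C (((1 / v) *\<^sub>C 1 - p) * ainv p))"
    using v by (simp add: left_diff_distrib ainv_right[OF assms(1)] scaleC_simps)
  then show "1 / v \<in> spectrum p"
    using assms v mult_invertible_cancel_right[OF ainv_invertible[OF assms(1)]]
    by (simp add: spectrum_iff minus_invertible scaleC_invertible)
qed

text \<open>
  If \<open>z\<close> is farther than \<open>r (x - y)\<close> from the spectrum of \<open>y\<close>, then \<open>(z - y)\<inverse> (x - y)\<close> has spectral
  radius less than one, and \<open>z - x = (z - y) (1 - (z - y)\<inverse> (x - y))\<close> is invertible.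
\<close>

lemma spectrum_perturbation:
  fixes x y :: "'a::complex_banach_algebra"
  assumes comm: "x * y = y * x" and z: "z \<in> spectrum x"
  obtains w where "w \<in> spectrum y" "cmod (z - w) \<le> spectral_radius (x - y)"
proof (rule ccontr)
  assume "\<not> thesis"
  then have far: "\<And>w. w \<in> spectrum y \<Longrightarrow> spectral_radius (x - y) < cmod (z - w)"
    using that by force
  let ?p = "z *\<^sub>C 1 - y"
  have "z \<notin> spectrum y" using far[of z] spectral_radius_nonneg[of "x - y"] by auto
  then have p: "?p \<in> invertibles" by (simp add: spectrum_iff)
  have pc: "(x - y) * ?p = ?p * (x - y)"
    using comm by (simp add: algebra_simps scaleC_simps)
  obtain v where v: "v \<in> spectrum (ainv ?p)" "cmod v = spectral_radius (ainv ?p)"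
    by (rule spectral_radius_attained)
  have v0: "v \<noteq> 0" and "1 / v \<in> spectrum ?p"
    using spectrum_ainv[OF p v(1)] by auto
  then have "z - 1 / v \<in> spectrum y"
    using minus_invertible[of "(z - 1 / v) *\<^sub>C 1 - y"] by (simp add: spectrum_iff scaleC_simps algebra_simps)
  from far[OF this] have "spectral_radius (x - y) < 1 / cmod v"
    by (simp add: norm_divide)
  then have "cmod v * spectral_radius (x - y) < 1"
    using v0 by (simp add: field_simps)
  moreover have "spectral_radius (ainv ?p * (x - y)) \<le> spectral_radius (ainv ?p) * spectral_radius (x - y)"
    by (rule spectral_radius_mult) (rule commute_ainv[OF p pc, symmetric])
  ultimately have "spectral_radius (ainv ?p * (x - y)) < 1"
    by (simp add: v(2))
  then have "1 \<notin> spectrum (ainv ?p * (x - y))"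
    using spectrum_le_spectral_radius[of 1] by force
  then have "?p * (1 - ainv ?p * (x - y)) \<in> invertibles"
    using p by (intro mult_invertible) (simp_all add: one_in_spectrum_iff)
  moreover have "?p * (1 - ainv ?p * (x - y)) = z *\<^sub>C 1 - x"
    by (simp add: right_diff_distrib[of ?p] ainv_cancel_left(1)[OF p])
  ultimately show False using z by (simp add: spectrum_iff)
qed

lemma spectral_radius_add:
  fixes x y :: "'a::complex_banach_algebra"
  assumes comm: "x * y = y * x"
  shows "spectral_radius (x + y) \<le> spectral_radius x + spectral_radius y"
proof -
  obtain z where z: "z \<in> spectrum (x + y)" "cmod z = spectral_radius (x + y)"
    by (rule spectral_radius_attained)
  have "(x + y) * y = y * (x + y)" using comm by (simp add: algebra_simps)
  from spectrum_perturbation[OF this z(1)]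
  obtain w where "w \<in> spectrum y" "cmod (z - w) \<le> spectral_radius x"
    by auto
  then show ?thesis
    using z(2) spectrum_le_spectral_radius[of w y] norm_triangle_sub[of z w] by linarith
qed

lemma spectral_radius_square:
  fixes x :: "'a::complex_banach_algebra"
  shows "spectral_radius (x * x) = spectral_radius x * spectral_radius x"
proof (rule antisym)
  show "spectral_radius (x * x) \<le> spectral_radius x * spectral_radius x"
    by (rule spectral_radius_mult) simp
  obtain z where z: "z \<in> spectrum x" "cmod z = spectral_radius x"
    by (rule spectral_radius_attained)
  have "z * z \<in> spectrum (x * x)"
  proof (rule ccontr)
    assume "z * z \<notin> spectrum (x * x)"
    moreover have "(z * z) *\<^sub>C 1 - x * x = (z *\<^sub>C 1 - x) * (z *\<^sub>C 1 + x)"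
      and "(z *\<^sub>C 1 - x) * (z *\<^sub>C 1 + x) = (z *\<^sub>C 1 + x) * (z *\<^sub>C 1 - x)"
      by (simp_all add: algebra_simps scaleC_simps)
    ultimately have "z *\<^sub>C 1 - x \<in> invertibles"
      using commuting_factor_invertible[of "z *\<^sub>C 1 - x" "z *\<^sub>C 1 + x"] by (simp add: spectrum_iff)
    then show False using z(1) by (simp add: spectrum_iff)
  qed
  from spectrum_le_spectral_radius[OF this]
  show "spectral_radius x * spectral_radius x \<le> spectral_radius (x * x)"
    by (simp add: norm_mult z(2))
qed

section \<open>Limits of weighted spectral radii\<close>

locale commutative_subalgebra =
  fixes D :: "'a::complex_banach_algebra set"
  assumes commute: "x \<in> D \<Longrightarrow> y \<in> D \<Longrightarrow> x * y = y * x"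
    and one_closed: "1 \<in> D"
    and add_closed: "x \<in> D \<Longrightarrow> y \<in> D \<Longrightarrow> x + y \<in> D"
    and mult_closed: "x \<in> D \<Longrightarrow> y \<in> D \<Longrightarrow> x * y \<in> D"
    and scaleC_closed: "x \<in> D \<Longrightarrow> c *\<^sub>C x \<in> D"
begin

lemma zero_closed: "0 \<in> D"
  using scaleC_closed[OF one_closed, of 0] by simp

lemma minus_closed: "x \<in> D \<Longrightarrow> - x \<in> D"
  using scaleC_closed[of x "-1"] by (simp add: scaleC_simps)

lemma diff_closed: "x \<in> D \<Longrightarrow> y \<in> D \<Longrightarrow> x - y \<in> D"
  using add_closed[of x "- y"] minus_closed[of y] by simp

lemma power_closed: "x \<in> D \<Longrightarrow> x ^ n \<in> D"
  by (induction n) (auto simp: one_closed mult_closed)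

lemmas closed = zero_closed one_closed add_closed mult_closed scaleC_closed minus_closed
  diff_closed power_closed

lemma radius_mult: "x \<in> D \<Longrightarrow> y \<in> D \<Longrightarrow> spectral_radius (x * y) \<le> spectral_radius x * spectral_radius y"
  by (rule spectral_radius_mult[OF commute])

lemma radius_add: "x \<in> D \<Longrightarrow> y \<in> D \<Longrightarrow> spectral_radius (x + y) \<le> spectral_radius x + spectral_radius y"
  by (rule spectral_radius_add[OF commute])

end

text \<open>
  Pointwise limits of the functions \<open>z \<mapsto> r (z g)\<close> with \<open>g \<in> D\<close>, that is, the closure of this set of
  functions in the topology of pointwise convergence on \<open>D\<close>. If normalized elements \<open>g\<close> peak ever more
  sharply on a part of the character space, the limit is the supremum of \<open>\<bar>z\<bar>\<close> over this part. The
  definition refers to products and spectral radii only, and so it is stable under multiplicative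
  spectrum-preserving bijections.
\<close>

definition spectral_limit :: "'a::complex_banach_algebra set \<Rightarrow> ('a \<Rightarrow> real) \<Rightarrow> bool" where
  "spectral_limit D f \<longleftrightarrow> (\<forall>E e. finite E \<longrightarrow> E \<subseteq> D \<longrightarrow> 0 < e \<longrightarrow>
     (\<exists>g\<in>D. \<forall>z\<in>E. \<bar>f z - spectral_radius (z * g)\<bar> < e))"

lemma spectral_limitD:
  assumes "spectral_limit D f" "finite E" "E \<subseteq> D" "0 < e"
  obtains g where "g \<in> D" "\<And>z. z \<in> E \<Longrightarrow> \<bar>f z - spectral_radius (z * g)\<bar> < e"
proof -
  have "\<exists>g\<in>D. \<forall>z\<in>E. \<bar>f z - spectral_radius (z * g)\<bar> < e"
    using assms by (simp add: spectral_limit_def)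
  then show thesis using that by blast
qed

lemma spectral_limit_tendsto:
  assumes F: "F \<noteq> bot" and f: "eventually (\<lambda>i. spectral_limit D (f i)) F"
    and u: "\<And>x. x \<in> D \<Longrightarrow> ((\<lambda>i. f i x) \<longlongrightarrow> u x) F"
  shows "spectral_limit D u"
  unfolding spectral_limit_def
proof (intro allI impI)
  fix E and e :: real
  assume E: "finite E" "E \<subseteq> D" and e: "0 < e"
  have "eventually (\<lambda>i. \<forall>z\<in>E. dist (f i z) (u z) < e / 2) F"
    using E e by (intro eventually_ball_finite ballI tendstoD[OF u]) auto
  with f have "eventually (\<lambda>i. spectral_limit D (f i) \<and> (\<forall>z\<in>E. dist (f i z) (u z) < e / 2)) F"
    by (rule eventually_conj)
  then obtain i where i: "spectral_limit D (f i)" "\<And>z. z \<in> E \<Longrightarrow> dist (f i z) (u z) < e / 2"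
    using eventually_happens F by blast
  obtain g where g: "g \<in> D" "\<And>z. z \<in> E \<Longrightarrow> \<bar>f i z - spectral_radius (z * g)\<bar> < e / 2"
    using spectral_limitD[OF i(1) E, of "e / 2"] e by auto
  have "\<bar>u z - spectral_radius (z * g)\<bar> < e" if "z \<in> E" for z
    using i(2)[OF that] g(2)[OF that] unfolding dist_real_def by linarith
  then show "\<exists>g\<in>D. \<forall>z\<in>E. \<bar>u z - spectral_radius (z * g)\<bar> < e"
    using g(1) by blast
qed

context commutative_subalgebra
begin

context
  fixes f :: "'a \<Rightarrow> real"
  assumes f: "spectral_limit D f"
begin

lemma spectral_limit_nonneg:
  assumes "x \<in> D"
  shows "0 \<le> f x"
proof (rule field_le_epsilon)
  fix e :: real assume "0 < e"
  obtain g where "\<bar>f x - spectral_radius (x * g)\<bar> < e"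
    using spectral_limitD[OF f, of "{x}" e] assms \<open>0 < e\<close> by auto
  then show "0 \<le> f x + e"
    using spectral_radius_nonneg[of "x * g"] by linarith
qed

lemma spectral_limit_add:
  assumes "x \<in> D" "y \<in> D"
  shows "f (x + y) \<le> f x + f y"
proof (rule field_le_epsilon)
  fix e :: real assume "0 < e"
  obtain g where g: "g \<in> D" "\<And>z. z \<in> {x, y, x + y} \<Longrightarrow> \<bar>f z - spectral_radius (z * g)\<bar> < e / 3"
    using spectral_limitD[OF f, of "{x, y, x + y}" "e / 3"] assms add_closed \<open>0 < e\<close> by auto
  have "spectral_radius ((x + y) * g) \<le> spectral_radius (x * g) + spectral_radius (y * g)"
    unfolding distrib_right using assms g(1) by (intro radius_add mult_closed)
  moreover have "\<bar>f x - spectral_radius (x * g)\<bar> < e / 3" "\<bar>f y - spectral_radius (y * g)\<bar> < e / 3"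
    "\<bar>f (x + y) - spectral_radius ((x + y) * g)\<bar> < e / 3"
    using g(2) by simp_all
  ultimately show "f (x + y) \<le> f x + f y + e"
    by linarith
qed

lemma spectral_limit_scaleC:
  assumes "x \<in> D"
  shows "f (c *\<^sub>C x) = cmod c * f x"
proof -
  have "\<bar>f (c *\<^sub>C x) - cmod c * f x\<bar> \<le> 0"
  proof (rule field_le_epsilon)
    fix e :: real assume e: "0 < e"
    define e' where "e' = e / (1 + cmod c)"
    have c: "0 < 1 + cmod c" by (simp add: add_pos_nonneg)
    have "e' + cmod c * e' = (1 + cmod c) * e'" by (simp add: algebra_simps)
    then have e': "0 < e'" "e' + cmod c * e' = e"
      using e c by (simp_all add: e'_def)
    obtain g where "g \<in> D" and g: "\<And>z. z \<in> {x, c *\<^sub>C x} \<Longrightarrow> \<bar>f z - spectral_radius (z * g)\<bar> < e'"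
      using spectral_limitD[OF f, of "{x, c *\<^sub>C x}" e'] assms scaleC_closed e' by auto
    have "\<bar>cmod c * f x - cmod c * spectral_radius (x * g)\<bar> \<le> cmod c * e'"
      using g[of x] by (simp add: abs_mult mult_left_mono flip: right_diff_distrib)
    moreover have "\<bar>f (c *\<^sub>C x) - cmod c * spectral_radius (x * g)\<bar> < e'"
      using g[of "c *\<^sub>C x"] by (simp add: mult_scaleC_left spectral_radius_scaleC)
    ultimately show "\<bar>f (c *\<^sub>C x) - cmod c * f x\<bar> \<le> 0 + e"
      using e'(2) by linarith
  qed
  then show ?thesis by simp
qed

lemma spectral_limit_diff:
  assumes "x \<in> D" "y \<in> D"
  shows "f (x - y) \<le> f x + f y" "f x \<le> f (x - y) + f y" "f (x - y) = f (y - x)"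
proof -
  have m: "f (- z) = f z" if "z \<in> D" for z
    using spectral_limit_scaleC[OF that, of "-1"] by (simp add: scaleC_simps)
  show "f (x - y) \<le> f x + f y"
    using spectral_limit_add[of x "- y"] assms by (simp add: m minus_closed)
  show "f x \<le> f (x - y) + f y"
    using spectral_limit_add[of "x - y" y] assms by (simp add: diff_closed)
  show "f (x - y) = f (y - x)"
    using m[of "x - y"] assms by (simp add: diff_closed)
qed

end

text \<open>
  An elementary proof of the Gelfand-Mazur theorem. The function \<open>\<alpha> \<mapsto> f (x - \<alpha>)\<close> attains its minimum
  \<open>m\<close>; suppose that \<open>m > 0\<close> and let \<open>y = x - \<alpha>\<close> with \<open>f y = m\<close>. For \<open>\<bar>\<mu>\<bar> < m\<close>, factor
  \<open>y\<^sup>N - \<mu>\<^sup>N\<close> into \<open>y - \<mu>\<close> and \<open>N - 1\<close> other linear factors, each of which has value at least \<open>m\<close>. This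
  gives \<open>f (y - \<mu>) m\<^sup>N \<le> m (m\<^sup>N + \<bar>\<mu>\<bar>\<^sup>N)\<close>, and \<open>N \<rightarrow> \<infinity>\<close> yields \<open>f (y - \<mu>) = m\<close>. So the function is constant
  on a disc of radius \<open>m\<close> around each of its minimum points, hence on a path to infinity, where it is unbounded.
\<close>

theorem multiplicative_seminorm_has_value:
  assumes f: "spectral_limit D f" and f1: "f 1 = 1"
    and mult: "\<And>x y. x \<in> D \<Longrightarrow> y \<in> D \<Longrightarrow> f (x * y) = f x * f y"
    and x: "x \<in> D"
  shows "\<exists>\<alpha>. f (x - \<alpha> *\<^sub>C 1) = 0"
proof -
  note [simp] = closed
  have scalar: "f (\<alpha> *\<^sub>C 1) = cmod \<alpha>" for \<alpha>
    using spectral_limit_scaleC[OF f one_closed] f1 by simp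
  have pow: "f (z ^ n) = f z ^ n" if "z \<in> D" for z n
    using that by (induction n) (simp_all add: f1 mult)
  let ?h = "\<lambda>\<alpha>. f (x - \<alpha> *\<^sub>C 1)"
  have lip: "?h \<alpha> \<le> ?h \<mu> + cmod (\<alpha> - \<mu>)" for \<alpha> \<mu>
  proof -
    have "?h \<alpha> = f ((x - \<mu> *\<^sub>C 1) - (\<alpha> - \<mu>) *\<^sub>C 1)"
      by (simp add: scaleC_simps)
    also have "\<dots> \<le> ?h \<mu> + f ((\<alpha> - \<mu>) *\<^sub>C 1)"
      using x by (intro spectral_limit_diff(1)[OF f]) simp_all
    finally show ?thesis by (simp add: scalar)
  qed
  have grow: "cmod \<alpha> - f x \<le> ?h \<alpha>" for \<alpha>
    using spectral_limit_diff(2,3)[OF f, of "\<alpha> *\<^sub>C 1" x] x by (simp add: scalar)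
  have "continuous_on (cball 0 (2 * f x)) ?h"
    unfolding continuous_on_iff
  proof (intro ballI allI impI)
    fix \<alpha> and e :: real assume "0 < e"
    have "dist (?h \<mu>) (?h \<alpha>) \<le> dist \<mu> \<alpha>" for \<mu>
      using lip[of \<mu> \<alpha>] lip[of \<alpha> \<mu>] by (simp add: dist_norm norm_minus_commute abs_le_iff)
    then show "\<exists>d>0. \<forall>\<mu>\<in>cball 0 (2 * f x). dist \<mu> \<alpha> < d \<longrightarrow> dist (?h \<mu>) (?h \<alpha>) < e"
      using \<open>0 < e\<close> by (intro exI[of _ e]) (auto intro: le_less_trans)
  qed
  moreover have "0 \<le> f x" by (rule spectral_limit_nonneg[OF f x])
  ultimately have "\<exists>\<alpha>0\<in>cball 0 (2 * f x). \<forall>\<alpha>\<in>cball 0 (2 * f x). ?h \<alpha>0 \<le> ?h \<alpha>"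
    by (intro continuous_attains_inf) auto
  then obtain \<alpha>0 where \<alpha>0: "\<And>\<alpha>. \<alpha> \<in> cball 0 (2 * f x) \<Longrightarrow> ?h \<alpha>0 \<le> ?h \<alpha>"
    by blast
  define m where "m = ?h \<alpha>0"
  have min: "m \<le> ?h \<alpha>" for \<alpha>
  proof (cases "\<alpha> \<in> cball 0 (2 * f x)")
    case True
    then show ?thesis using \<alpha>0 by (simp add: m_def)
  next
    case False
    then have "f x \<le> ?h \<alpha>" using grow[of \<alpha>] by simp
    moreover have "m \<le> ?h 0" using \<alpha>0[of 0] \<open>0 \<le> f x\<close> by (simp add: m_def)
    ultimately show ?thesis by simp
  qed
  have "m = 0"
  proof (rule ccontr)
    assume "m \<noteq> 0"
    moreover have "0 \<le> m" unfolding m_def by (rule spectral_limit_nonneg[OF f]) (simp add: x)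
    ultimately have m: "0 < m" by simp
    have flat: "?h (\<alpha> + \<mu>) = m" if \<alpha>: "?h \<alpha> = m" and \<mu>: "cmod \<mu> < m" for \<alpha> \<mu>
    proof -
      define y where "y = x - \<alpha> *\<^sub>C 1"
      have y: "y \<in> D" "f y = m" using x \<alpha> by (simp_all add: y_def)
      have shift: "y - \<nu> *\<^sub>C 1 = x - (\<alpha> + \<nu>) *\<^sub>C 1" for \<nu>
        by (simp add: y_def scaleC_simps)
      have low: "f (y - \<nu> *\<^sub>C 1) * m ^ 2 ^ n \<le> m * f (y ^ 2 ^ n - \<nu> ^ 2 ^ n *\<^sub>C 1)" for n \<nu>
      proof (induction n arbitrary: \<nu>)
        case (Suc n)
        let ?N = "2 ^ n :: nat"
        \<comment> \<open>Only powers of two are used: \<open>y\<^sup>2\<^sup>N - \<nu>\<^sup>2\<^sup>N = (y\<^sup>N - \<nu>\<^sup>N) (y\<^sup>N - (\<omega> \<nu>)\<^sup>N)\<close> when \<open>\<omega>\<^sup>N = -1\<close>.\<close>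
        define \<omega> where "\<omega> = cis (pi / 2 ^ n)"
        have "\<omega> ^ ?N = cis (real ?N * (pi / 2 ^ n))" unfolding \<omega>_def by (rule Complex.DeMoivre)
        then have \<omega>: "\<omega> ^ ?N = -1" by simp
        let ?p = "y ^ ?N - \<nu> ^ ?N *\<^sub>C 1" and ?q = "y ^ ?N - (\<omega> * \<nu>) ^ ?N *\<^sub>C 1"
        have "m * m ^ ?N \<le> f (y - (\<omega> * \<nu>) *\<^sub>C 1) * m ^ ?N"
          unfolding shift using m by (intro mult_right_mono min) simp
        also have "\<dots> \<le> m * f ?q" by (rule Suc.IH)
        finally have q: "m ^ ?N \<le> f ?q" using m by simp
        have p: "f (y - \<nu> *\<^sub>C 1) * m ^ ?N \<le> m * f ?p" by (rule Suc.IH)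
        have "f (y - \<nu> *\<^sub>C 1) * m ^ 2 ^ Suc n = (f (y - \<nu> *\<^sub>C 1) * m ^ ?N) * m ^ ?N"
          by (simp add: mult_2 power_add)
        also have "\<dots> \<le> (m * f ?p) * f ?q"
          using m y by (intro mult_mono[OF p q] mult_nonneg_nonneg spectral_limit_nonneg[OF f]) simp_all
        also have "\<dots> = m * f (?p * ?q)" using y by (simp add: mult)
        also have "?p * ?q = y ^ 2 ^ Suc n - \<nu> ^ 2 ^ Suc n *\<^sub>C 1"
          by (simp add: \<omega> mult_2 power_add algebra_simps scaleC_simps)
        finally show ?case .
      qed (simp add: mult.commute)
      have "f (y - \<mu> *\<^sub>C 1) \<le> m"
      proof (rule field_le_epsilon)
        fix e :: real assume "0 < e"
        let ?q = "cmod \<mu> / m"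
        have q: "0 \<le> ?q" "?q < 1" using \<mu> m by simp_all
        obtain n where n: "?q ^ n < e / m"
          using real_arch_pow_inv[of "e / m" ?q] \<open>0 < e\<close> m q by auto
        have "?q ^ 2 ^ n \<le> ?q ^ n"
          using q less_exp[of n] by (intro power_decreasing) auto
        then have "?q ^ 2 ^ n < e / m" using n by simp
        then have b: "cmod \<mu> ^ 2 ^ n * m < e * m ^ 2 ^ n"
          using m by (simp add: power_divide field_simps)
        have "f (y ^ 2 ^ n - \<mu> ^ 2 ^ n *\<^sub>C 1) \<le> m ^ 2 ^ n + cmod \<mu> ^ 2 ^ n"
          using spectral_limit_diff(1)[OF f, of "y ^ 2 ^ n" "\<mu> ^ 2 ^ n *\<^sub>C 1"] y
          by (simp add: pow scalar norm_power)
        then have "m * f (y ^ 2 ^ n - \<mu> ^ 2 ^ n *\<^sub>C 1) \<le> m * (m ^ 2 ^ n + cmod \<mu> ^ 2 ^ n)"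
          using m by (intro mult_left_mono) auto
        then have "f (y - \<mu> *\<^sub>C 1) * m ^ 2 ^ n \<le> (m + e) * m ^ 2 ^ n"
          using low[of \<mu> n] b by (simp add: algebra_simps)
        then show "f (y - \<mu> *\<^sub>C 1) \<le> m + e" using m by simp
      qed
      then show ?thesis using min[of "\<alpha> + \<mu>"] by (simp add: shift)
    qed
    have const: "?h (\<alpha>0 + of_real (real j * (m / 2))) = m" for j
    proof (induction j)
      case (Suc j)
      have "\<alpha>0 + of_real (real (Suc j) * (m / 2)) = (\<alpha>0 + of_real (real j * (m / 2))) + of_real (m / 2)"
        by (simp add: algebra_simps)
      then show ?case by (simp only:) (rule flat[OF Suc], use m in simp)
    qed (simp add: m_def)
    obtain j :: nat where j: "(m + f x + cmod \<alpha>0) / (m / 2) < real j"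
      using reals_Archimedean2 by blast
    let ?t = "of_real (real j * (m / 2)) :: complex"
    have "m + f x + cmod \<alpha>0 < real j * (m / 2)" using j m by (simp add: field_simps)
    also have "\<dots> = cmod ?t" using m by (simp only: norm_of_real) simp
    finally show False
      using grow[of "\<alpha>0 + ?t"] const[of j] norm_triangle_sub[of ?t "- \<alpha>0"] by (simp add: add.commute)
  qed
  then show ?thesis unfolding m_def by (rule exI)
qed

end

section \<open>Minimal peak seminorms\<close>

context commutative_subalgebra
begin

text \<open>
  The behaviour expected of \<open>f z = sup \<bar>z\<bar>\<close> over a set of characters. The value zero outside \<open>D\<close> makes the
  functions comparable as functions on the whole type, so that their pointwise order is antisymmetric.
\<close>

definition peak_seminorms :: "('a \<Rightarrow> real) set" where
  "peak_seminorms = {f. spectral_limit D f \<and> f 1 = 1 \<and>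
     (\<forall>x\<in>D. \<forall>y\<in>D. f (x * y) \<le> f x * f y) \<and> (\<forall>x\<in>D. f (x * x) = f x * f x) \<and>
     (\<forall>x. x \<notin> D \<longrightarrow> f x = 0)}"

lemma peak_seminormsD:
  assumes "f \<in> peak_seminorms"
  shows "spectral_limit D f" "f 1 = 1" "x \<in> D \<Longrightarrow> y \<in> D \<Longrightarrow> f (x * y) \<le> f x * f y"
    "x \<in> D \<Longrightarrow> f (x * x) = f x * f x" "x \<notin> D \<Longrightarrow> f x = 0" "0 \<le> f x"
proof -
  show lim: "spectral_limit D f" and "f 1 = 1" and "x \<in> D \<Longrightarrow> y \<in> D \<Longrightarrow> f (x * y) \<le> f x * f y"
    and "x \<in> D \<Longrightarrow> f (x * x) = f x * f x" and out: "x \<notin> D \<Longrightarrow> f x = 0"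
    using assms by (auto simp: peak_seminorms_def)
  show "0 \<le> f x" using spectral_limit_nonneg[OF lim, of x] out by (cases "x \<in> D") auto
qed

text \<open>
  Compatibility with squares gives the powers of exponent \<open>2 ^ n\<close>, and for the others submultiplicativity is
  squeezed in \<open>f z ^ 2 ^ n \<le> f (z ^ n) * f z ^ (2 ^ n - n)\<close>.
\<close>

lemma peak_seminorm_power:
  assumes f: "f \<in> peak_seminorms" and z: "z \<in> D"
  shows "f (z ^ n) = f z ^ n"
proof (cases "f z = 0")
  case True
  have "f (z ^ Suc k) \<le> f z * f (z ^ k)" for k
    using peak_seminormsD(3)[OF f z power_closed[OF z]] by simp
  then have "f (z ^ Suc k) = 0" for k
    using True peak_seminormsD(6)[OF f, of "z ^ Suc k"] by (metis mult_zero_left order_antisym)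
  then show ?thesis using True peak_seminormsD(2)[OF f] by (cases n) auto
next
  case False
  then have pos: "0 < f z" using peak_seminormsD(6)[OF f, of z] by simp
  have le: "f (z ^ k) \<le> f z ^ k" for k
  proof (induction k)
    case (Suc k)
    have "f (z ^ Suc k) \<le> f z * f (z ^ k)"
      using peak_seminormsD(3)[OF f z power_closed[OF z]] by simp
    also have "\<dots> \<le> f z * f z ^ k" using Suc pos by (intro mult_left_mono) auto
    finally show ?case by simp
  qed (simp add: peak_seminormsD(2)[OF f])
  have dyadic: "f (z ^ 2 ^ k) = f z ^ 2 ^ k" for k
  proof (induction k)
    case (Suc k)
    then show ?case
      using peak_seminormsD(4)[OF f power_closed[OF z, of "2 ^ k"]] by (simp add: mult_2 power_add)
  qed simp
  have n: "n \<le> 2 ^ n" using less_exp[of n] by simp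
  have "f z ^ n * f z ^ (2 ^ n - n) = f (z ^ n * z ^ (2 ^ n - n))"
    using n by (simp add: dyadic flip: power_add)
  also have "\<dots> \<le> f (z ^ n) * f (z ^ (2 ^ n - n))"
    by (intro peak_seminormsD(3)[OF f] power_closed z)
  also have "\<dots> \<le> f (z ^ n) * f z ^ (2 ^ n - n)"
    by (intro mult_left_mono le peak_seminormsD(6)[OF f])
  finally have "f z ^ n \<le> f (z ^ n)" using pos by simp
  with le show ?thesis by (intro antisym)
qed

text \<open>
  If \<open>f\<close> is the supremum over a set of characters, then \<open>f1\<close> is the supremum over the subset on which
  \<open>\<bar>z\<bar>\<close> takes its maximal value \<open>f z\<close>. The sequence decreases by submultiplicativity, and weighting \<open>g\<close>
  with \<open>z\<^sup>k / (f z)\<^sup>k\<close> shows that its terms are limits of weighted spectral radii.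
\<close>

lemma peak_seminorm_localize:
  assumes f: "f \<in> peak_seminorms" and z: "z \<in> D" and fz: "f z \<noteq> 0"
  shows "\<exists>f1\<in>peak_seminorms. \<forall>w\<in>D. (\<lambda>k. f (z ^ k * w) / f z ^ k) \<longlonglongrightarrow> f1 w \<and>
    f1 w \<le> f (z * w) / f z"
proof -
  note fD = peak_seminormsD[OF f] and [simp] = closed z
  have pos: "0 < f z" using fz fD(6)[of z] by simp
  define g where "g k w = f (z ^ k * w) / f z ^ k" for k w
  have dec: "g (Suc k) w \<le> g k w" if "w \<in> D" for k w
  proof -
    have "f (z * (z ^ k * w)) \<le> f z * f (z ^ k * w)"
      using that by (intro fD(3)) simp_all
    then show ?thesis using pos by (simp add: g_def divide_simps mult.assoc mult.commute)
  qed
  have nonneg: "0 \<le> g k w" for k w using fD(6) pos by (simp add: g_def)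
  have "\<exists>l. (\<lambda>k. g k w) \<longlonglongrightarrow> l" if "w \<in> D" for w
    using decseq_convergent[of "\<lambda>k. g k w" 0] dec[OF that] nonneg decseq_SucI by metis
  then obtain f0 where f0: "\<And>w. w \<in> D \<Longrightarrow> (\<lambda>k. g k w) \<longlonglongrightarrow> f0 w" by metis
  define f1 where "f1 w = (if w \<in> D then f0 w else 0)" for w
  have lim: "(\<lambda>k. g k w) \<longlonglongrightarrow> f1 w" if "w \<in> D" for w using f0 that by (simp add: f1_def)
  \<comment> \<open>A product \<open>x y\<close> absorbs \<open>z\<^sup>k\<close> twice, which makes the even terms of the sequence comparable with products.\<close>
  have lim2: "(\<lambda>k. g (2 * k) w) \<longlonglongrightarrow> f1 w" if "w \<in> D" for w
    using LIMSEQ_subseq_LIMSEQ[OF lim[OF that], of "\<lambda>k. 2 * k"] by (simp add: strict_mono_def comp_def)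
  have "f1 w \<le> g 1 w" if "w \<in> D" for w
    using decseq_ge[OF decseq_SucI lim[OF that], of 1] dec[OF that] by blast
  moreover have "f1 \<in> peak_seminorms"
    unfolding peak_seminorms_def mem_Collect_eq
  proof (intro conjI ballI allI impI)
    have "spectral_limit D (g k)" for k
      unfolding spectral_limit_def
    proof (intro allI impI)
      fix E and e :: real assume E: "finite E" "E \<subseteq> D" "0 < e"
      have "finite ((\<lambda>w. z ^ k * w) ` E)" "(\<lambda>w. z ^ k * w) ` E \<subseteq> D" "0 < e * f z ^ k"
        using E pos by auto
      then obtain h where h: "h \<in> D"
        "\<And>w. w \<in> (\<lambda>w. z ^ k * w) ` E \<Longrightarrow> \<bar>f w - spectral_radius (w * h)\<bar> < e * f z ^ k"
        by (rule spectral_limitD[OF fD(1)]) blast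
      let ?h = "complex_of_real (1 / f z ^ k) *\<^sub>C (z ^ k * h)"
      have "\<bar>g k w - spectral_radius (w * ?h)\<bar> < e" if w: "w \<in> E" for w
      proof -
        have "w * (z ^ k * h) = z ^ k * w * h"
          using E w commute[of w "z ^ k"] by (auto simp flip: mult.assoc)
        then have "spectral_radius (w * ?h) = spectral_radius (z ^ k * w * h) / f z ^ k"
          using pos by (simp add: mult_scaleC_right spectral_radius_scaleC norm_divide norm_power)
        then have "g k w - spectral_radius (w * ?h) = (f (z ^ k * w) - spectral_radius (z ^ k * w * h)) / f z ^ k"
          by (simp add: g_def diff_divide_distrib)
        then show ?thesis
          using h(2)[of "z ^ k * w"] w pos by (simp add: abs_divide divide_less_eq)
      qed
      then show "\<exists>h\<in>D. \<forall>w\<in>E. \<bar>g k w - spectral_radius (w * h)\<bar> < e"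
        using h(1) by (intro bexI[of _ ?h]) simp_all
    qed
    then show "spectral_limit D f1"
      using lim by (intro spectral_limit_tendsto[where F = sequentially and f = g]) auto
    have "g k 1 = 1" for k
      using pos by (simp add: g_def peak_seminorm_power[OF f])
    then show "f1 1 = 1" using LIMSEQ_unique[OF lim[OF one_closed], of 1] by simp
  next
    fix x y assume xy: "x \<in> D" "y \<in> D"
    have "g (2 * k) (x * y) \<le> g k x * g k y" for k
    proof -
      have "z ^ k * (z ^ k * (x * y)) = z ^ k * (z ^ k * x) * y" by (simp add: mult.assoc)
      also have "z ^ k * (z ^ k * x) = z ^ k * x * z ^ k" using xy by (intro commute) simp_all
      finally have "f (z ^ (2 * k) * (x * y)) = f ((z ^ k * x) * (z ^ k * y))"
        by (simp add: mult_2 power_add mult.assoc)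
      also have "\<dots> \<le> f (z ^ k * x) * f (z ^ k * y)" using xy by (intro fD(3)) simp_all
      finally show ?thesis using pos by (simp add: g_def mult_2 power_add divide_right_mono)
    qed
    then show "f1 (x * y) \<le> f1 x * f1 y"
      using xy by (intro LIMSEQ_le[OF lim2 tendsto_mult[OF lim lim]]) auto
  next
    fix x assume x: "x \<in> D"
    have "g (2 * k) (x * x) = g k x * g k x" for k
    proof -
      have "z ^ k * (z ^ k * (x * x)) = z ^ k * (z ^ k * x) * x" by (simp add: mult.assoc)
      also have "z ^ k * (z ^ k * x) = z ^ k * x * z ^ k" using x by (intro commute) simp_all
      finally have "f (z ^ (2 * k) * (x * x)) = f ((z ^ k * x) * (z ^ k * x))"
        by (simp add: mult_2 power_add mult.assoc)
      also have "\<dots> = f (z ^ k * x) * f (z ^ k * x)" using x by (intro fD(4)) simp_all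
      finally show ?thesis by (simp add: g_def mult_2 power_add)
    qed
    then have "(\<lambda>k. g (2 * k) (x * x)) \<longlonglongrightarrow> f1 x * f1 x"
      using tendsto_mult[OF lim[OF x] lim[OF x]] by simp
    then show "f1 (x * x) = f1 x * f1 x"
      using LIMSEQ_unique lim2 x by (metis mult_closed)
  qed (simp add: f1_def)
  ultimately show ?thesis
    using lim by (intro bexI[of _ f1]) (simp_all add: g_def)
qed

lemma spectral_radius_peak_seminorm:
  "(\<lambda>x. if x \<in> D then spectral_radius x else 0) \<in> peak_seminorms"
  unfolding peak_seminorms_def mem_Collect_eq spectral_limit_def
proof (intro conjI allI impI ballI)
  fix E and e :: real assume "E \<subseteq> D" "0 < e"
  then show "\<exists>g\<in>D. \<forall>z\<in>E. \<bar>(if z \<in> D then spectral_radius z else 0) - spectral_radius (z * g)\<bar> < e"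
    by (intro bexI[of _ 1]) (auto simp: one_closed)
qed (auto simp: closed radius_mult spectral_radius_square)

text \<open>
  Zorn's lemma gives a minimal \<open>f\<close> among the peak seminorms with \<open>f (d w) = f w\<close>, a property that forces
  \<open>f d = 1\<close>; there are such seminorms because the spectral radius can be localized at \<open>d\<close>. Localizing \<open>f\<close>
  at an element \<open>x\<close> with \<open>f x \<noteq> 0\<close> keeps this property and does not increase \<open>f\<close>. By minimality the
  localization is \<open>f\<close> itself, so that \<open>f y \<le> f (x y) / f x\<close>.
\<close>

theorem multiplicative_peak_seminorm_exists:
  assumes d: "d \<in> D" "spectral_radius d = 1"
  obtains f where "spectral_limit D f" "f 1 = 1" "f d = 1"
    "\<And>x y. x \<in> D \<Longrightarrow> y \<in> D \<Longrightarrow> f (x * y) = f x * f y"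
proof -
  define A where "A = {f \<in> peak_seminorms. \<forall>w\<in>D. f (d * w) = f w}"
  define R where "R f g \<longleftrightarrow> (\<forall>x. g x \<le> f x)" for f g :: "'a \<Rightarrow> real"
  let ?r = "\<lambda>x. if x \<in> D then spectral_radius x else 0"
  have "?r d \<noteq> 0" using d by simp
  then obtain f0 where f0: "f0 \<in> peak_seminorms"
    and lim: "\<And>w. w \<in> D \<Longrightarrow> (\<lambda>k. ?r (d ^ k * w) / ?r d ^ k) \<longlonglongrightarrow> f0 w"
    using peak_seminorm_localize[OF spectral_radius_peak_seminorm d(1)] by meson
  have "f0 (d * w) = f0 w" if w: "w \<in> D" for w
  proof (rule LIMSEQ_unique)
    show "(\<lambda>k. ?r (d ^ k * (d * w)) / ?r d ^ k) \<longlonglongrightarrow> f0 (d * w)"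
      using w d by (intro lim mult_closed)
    have "(\<lambda>k. ?r (d ^ Suc k * w) / ?r d ^ Suc k) \<longlonglongrightarrow> f0 w"
      by (rule LIMSEQ_Suc[OF lim[OF w]])
    then show "(\<lambda>k. ?r (d ^ k * (d * w)) / ?r d ^ k) \<longlonglongrightarrow> f0 w"
      using d by (simp only: power_Suc2 mult.assoc) simp
  qed
  then have ne: "f0 \<in> A" using f0 by (simp add: A_def)
  have "\<exists>f\<in>A. \<forall>g\<in>A. R f g \<longrightarrow> g = f"
  proof (rule predicate_Zorn)
    have "R f f" "R f g \<Longrightarrow> R g h \<Longrightarrow> R f h" for f g h
      unfolding R_def by (auto intro: order_trans)
    moreover have "R f g \<Longrightarrow> R g f \<Longrightarrow> f = g" for f g
      unfolding R_def fun_eq_iff by (blast intro: order_antisym)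
    ultimately show "partial_order_on A (relation_of R A)"
      unfolding partial_order_on_def preorder_on_def refl_on_def trans_def antisym_def relation_of_def
      by blast
    fix C assume C: "C \<in> Chains (relation_of R A)"
    have CA: "C \<subseteq> A" and tot: "\<And>f g. f \<in> C \<Longrightarrow> g \<in> C \<Longrightarrow> R f g \<or> R g f"
      using C by (auto simp: Chains_def relation_of_def)
    show "\<exists>u\<in>A. \<forall>a\<in>C. R a u"
    proof (cases "C = {}")
      case True
      then show ?thesis using ne by blast
    next
      case False
      define u where "u x = (INF f\<in>C. f x)" for x
      \<comment> \<open>The chain as a filter: along \<open>F\<close> its members converge pointwise to their infimum \<open>u\<close>, which therefore satisfies all closed conditions.\<close>
      define F where "F = (INF f\<in>C. principal {g \<in> C. R f g})"
      have ev: "eventually P F \<longleftrightarrow> (\<exists>f\<in>C. \<forall>g\<in>C. R f g \<longrightarrow> P g)" for P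
        unfolding F_def
      proof (subst eventually_INF_base)
        fix f g assume "f \<in> C" "g \<in> C"
        then show "\<exists>h\<in>C. principal {k \<in> C. R h k} \<le> inf (principal {k \<in> C. R f k}) (principal {k \<in> C. R g k})"
          using tot[of f g] by (auto simp: R_def intro: order_trans)
      qed (auto simp: eventually_principal False)
      have refl: "R f f" for f by (simp add: R_def)
      have F: "F \<noteq> bot"
        using ev[of "\<lambda>_. False"] refl by (auto simp: trivial_limit_def)
      have inC: "eventually (\<lambda>f. f \<in> C) F" using ev False by blast
      have bdd: "bdd_below ((\<lambda>f. f x) ` C)" for x
        using CA peak_seminormsD(6) by (intro bdd_belowI[of _ 0]) (auto simp: A_def)
      have u: "((\<lambda>f. f x) \<longlongrightarrow> u x) F" for x
      proof (rule order_tendstoI)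
        fix a assume a: "a < u x"
        have "u x \<le> f x" if "f \<in> C" for f
          unfolding u_def using that by (intro cINF_lower bdd)
        then show "eventually (\<lambda>f. a < f x) F"
          using inC a by (auto elim!: eventually_mono intro: less_le_trans)
      next
        fix a assume "u x < a"
        then obtain f where "f \<in> C" "f x < a"
          unfolding u_def using cInf_less_iff[OF _ bdd[of x]] False by auto
        then show "eventually (\<lambda>f. f x < a) F"
          unfolding ev R_def by (meson le_less_trans)
      qed
      have lims: "eventually (\<lambda>f. f \<in> A) F" using inC CA by (auto elim: eventually_mono)
      have evA: "eventually P F" if "\<And>f. f \<in> A \<Longrightarrow> P f" for P
        using lims that by (rule eventually_mono)
      have "u \<in> A"
        unfolding A_def peak_seminorms_def mem_Collect_eq
      proof (intro conjI ballI allI impI)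
        show "spectral_limit D u"
          using F by (rule spectral_limit_tendsto[OF _ evA u]) (auto simp: A_def peak_seminormsD)
        show "u 1 = 1"
          by (rule tendsto_unique[OF F u]) (rule tendsto_eventually, rule evA, auto simp: A_def peak_seminormsD)
        fix x
        show "u x = 0" if "x \<notin> D"
          by (rule tendsto_unique[OF F u]) (rule tendsto_eventually, rule evA, use that in \<open>auto simp: A_def peak_seminormsD\<close>)
        assume x: "x \<in> D"
        show "u (d * x) = u x"
          by (rule tendsto_unique[OF F u Lim_transform_eventually[OF u]])
            (rule evA, use x in \<open>simp add: A_def\<close>)
        show "u (x * x) = u x * u x"
          by (rule tendsto_unique[OF F u Lim_transform_eventually[OF tendsto_mult[OF u u]]])
            (rule evA, use x in \<open>simp add: A_def peak_seminormsD\<close>)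
        fix y assume "y \<in> D"
        then show "u (x * y) \<le> u x * u y"
          using x by (intro tendsto_le[OF F tendsto_mult[OF u u] u] evA) (simp add: A_def peak_seminormsD)
      qed
      moreover have "R a u" if "a \<in> C" for a
        unfolding R_def u_def using that by (auto intro: cINF_lower bdd)
      ultimately show ?thesis by blast
    qed
  qed
  then obtain f where f: "f \<in> A" and min: "\<And>g. g \<in> A \<Longrightarrow> R f g \<Longrightarrow> g = f" by blast
  have fp: "f \<in> peak_seminorms" and fd: "\<And>w. w \<in> D \<Longrightarrow> f (d * w) = f w"
    using f by (auto simp: A_def)
  note fD = peak_seminormsD[OF fp]
  have mult: "f (x * y) = f x * f y" if xy: "x \<in> D" "y \<in> D" for x y
  proof (cases "f x = 0")
    case True
    then show ?thesis using fD(3)[OF xy] fD(6)[of "x * y"] by simp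
  next
    case False
    then have pos: "0 < f x" using fD(6)[of x] by simp
    obtain f1 where f1: "f1 \<in> peak_seminorms"
      "\<And>w. w \<in> D \<Longrightarrow> (\<lambda>k. f (x ^ k * w) / f x ^ k) \<longlonglongrightarrow> f1 w"
      "\<And>w. w \<in> D \<Longrightarrow> f1 w \<le> f (x * w) / f x"
      using peak_seminorm_localize[OF fp xy(1) False] by blast
    have "f1 (d * w) = f1 w" if w: "w \<in> D" for w
    proof (rule LIMSEQ_unique[OF f1(2)])
      show "d * w \<in> D" using d w by (intro mult_closed)
      have "x ^ k * (d * w) = d * (x ^ k * w)" for k
        using commute[of "x ^ k" d] d xy by (simp add: power_closed flip: mult.assoc)
      then have "f (x ^ k * (d * w)) = f (x ^ k * w)" for k
        using fd[of "x ^ k * w"] w xy by (simp add: closed)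
      then show "(\<lambda>k. f (x ^ k * (d * w)) / f x ^ k) \<longlonglongrightarrow> f1 w"
        using f1(2)[OF w] by simp
    qed
    then have "f1 \<in> A" using f1(1) by (simp add: A_def)
    moreover have "f1 w \<le> f w" for w
    proof (cases "w \<in> D")
      case True
      have "f (x * w) / f x \<le> f w" using fD(3)[OF xy(1) True] pos by (simp add: field_simps)
      then show ?thesis using f1(3)[OF True] by simp
    qed (simp add: fD(5) peak_seminormsD(5)[OF f1(1)])
    ultimately have "f1 = f" using min by (simp add: R_def)
    then have "f y \<le> f (x * y) / f x" using f1(3)[OF xy(2)] by simp
    then have "f x * f y \<le> f (x * y)" using pos by (simp add: field_simps)
    then show ?thesis using fD(3)[OF xy] by simp
  qed
  show thesis
    by (rule that[of f]) (use fD(1,2) fd[OF one_closed] mult in simp_all)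
qed

end

section \<open>Multiplicative spectrum-preserving bijections of commutative algebras\<close>

locale spectral_bijection = A: commutative_subalgebra C + B: commutative_subalgebra D
  for C :: "'a::complex_banach_algebra set" and D :: "'b::complex_banach_algebra set" +
  fixes \<phi> :: "'a \<Rightarrow> 'b"
  assumes bij: "bij_betw \<phi> C D"
    and mult: "x \<in> C \<Longrightarrow> y \<in> C \<Longrightarrow> \<phi> (x * y) = \<phi> x * \<phi> y"
    and scaleC: "x \<in> C \<Longrightarrow> \<phi> (c *\<^sub>C x) = c *\<^sub>C \<phi> x"
    and spectrum: "x \<in> C \<Longrightarrow> spectrum (\<phi> x) = spectrum x"
begin

lemma image_closed: "x \<in> C \<Longrightarrow> \<phi> x \<in> D"
  using bij by (auto simp: bij_betw_def)

lemma preimage: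
  assumes "y \<in> D" obtains x where "x \<in> C" "\<phi> x = y"
  using assms bij by (auto simp: bij_betw_def)

lemma image_one: "\<phi> 1 = 1"
proof -
  obtain e where "e \<in> C" "\<phi> e = 1" using preimage[OF B.one_closed] by blast
  then show ?thesis using mult[OF A.one_closed, of e] by simp
qed

lemma radius: "x \<in> C \<Longrightarrow> spectral_radius (\<phi> x) = spectral_radius x"
  by (rule spectral_radius_cong[OF spectrum])

text \<open>
  This relates sums in \<open>C\<close> to sums in \<open>D\<close>: as a limit of weighted spectral radii, \<open>f \<circ> \<phi>\<close> is
  subadditive on \<open>C\<close>, although \<open>\<phi>\<close> is not known to respect sums.
\<close>

lemma spectral_limit_transport:
  assumes f: "spectral_limit D f"
  shows "spectral_limit C (f \<circ> \<phi>)"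
  unfolding spectral_limit_def
proof (intro allI impI)
  fix E and e :: real assume E: "finite E" "E \<subseteq> C" "0 < e"
  have "finite (\<phi> ` E)" "\<phi> ` E \<subseteq> D" using E image_closed by auto
  then obtain g where g: "g \<in> D" "\<And>z. z \<in> \<phi> ` E \<Longrightarrow> \<bar>f z - spectral_radius (z * g)\<bar> < e"
    using E(3) by (rule spectral_limitD[OF f]) blast
  obtain h where h: "h \<in> C" "\<phi> h = g" using preimage[OF g(1)] by blast
  have "\<bar>(f \<circ> \<phi>) z - spectral_radius (z * h)\<bar> < e" if "z \<in> E" for z
  proof -
    have "spectral_radius (z * h) = spectral_radius (\<phi> z * g)"
      using E(2) that h radius[of "z * h"] by (auto simp: mult A.mult_closed)
    then show ?thesis using g(2)[of "\<phi> z"] that by simp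
  qed
  then show "\<exists>h\<in>C. \<forall>z\<in>E. \<bar>(f \<circ> \<phi>) z - spectral_radius (z * h)\<bar> < e"
    using h(1) by blast
qed

end

text \<open>
  On the closed unit disc the polynomial \<open>z (1 + z) / 2\<close> attains modulus one at \<open>z = 1\<close> only. It therefore
  turns an element \<open>g\<close> with \<open>r g = 1\<close> and \<open>1 \<in> \<sigma> g\<close> into one whose peripheral spectrum is \<open>{1}\<close>.
\<close>

lemma modulus_peaked_at_one:
  fixes z :: complex
  assumes "cmod z \<le> 1" "1 \<le> cmod (z * (1 + z) / 2)"
  shows "z = 1"
proof -
  have "cmod (1 + z) \<le> 2" using norm_triangle_ineq[of 1 z] assms(1) by simp
  then have "cmod z * cmod (1 + z) \<le> cmod z * 2" by (intro mult_left_mono) auto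
  with assms have z: "cmod z = 1" by (simp add: norm_mult norm_divide)
  then have "2 \<le> cmod (1 + z)" using assms(2) by (simp add: norm_mult norm_divide)
  then have "2\<^sup>2 \<le> (cmod (1 + z))\<^sup>2" by (intro power_mono) auto
  moreover have "(Re z)\<^sup>2 + (Im z)\<^sup>2 = 1" using z by (simp add: cmod_def)
  moreover have "(cmod (1 + z))\<^sup>2 = (1 + Re z)\<^sup>2 + (Im z)\<^sup>2" by (simp add: cmod_power2)
  ultimately have "1 \<le> Re z" by (simp add: power2_eq_square algebra_simps)
  moreover from this have "1 * 1 \<le> Re z * Re z" by (intro mult_mono) auto
  ultimately show "z = 1"
    using \<open>(Re z)\<^sup>2 + (Im z)\<^sup>2 = 1\<close> abs_Re_le_cmod[of z] z
    by (intro complex_eqI) (auto simp: power2_eq_square)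
qed

lemma spectrum_peak_polynomial:
  fixes g :: "'a::complex_banach_algebra"
  assumes "t \<in> spectrum ((1 / 2) *\<^sub>C (g * (1 + g)))"
  obtains z where "z \<in> spectrum g" "t = z * (1 + z) / 2"
proof -
  define z where "z = (csqrt (1 + 8 * t) - 1) / 2"
  have zz: "z * (1 + z) = 2 * t"
  proof -
    have "z * (1 + z) = ((csqrt (1 + 8 * t))\<^sup>2 - 1) / 4"
      by (simp add: z_def power2_eq_square field_simps)
    then show ?thesis by simp
  qed
  let ?w = "- 1 - z"
  have ww: "?w * (1 + ?w) = 2 * t" using zz by (simp add: algebra_simps)
  have "(z *\<^sub>C 1 - g) * (?w *\<^sub>C 1 - g) = (z * ?w) *\<^sub>C 1 - (z + ?w) *\<^sub>C g + g * g"
    by (simp add: algebra_simps scaleC_simps)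
  also have "z * ?w = - 2 * t" using zz by (simp add: algebra_simps)
  also have "z + ?w = - 1" by simp
  finally have prod: "(z *\<^sub>C 1 - g) * (?w *\<^sub>C 1 - g) = (- 2 * t) *\<^sub>C 1 - (- 1) *\<^sub>C g + g * g" .
  have "t *\<^sub>C 1 - (1 / 2) *\<^sub>C (g * (1 + g)) = - ((1 / 2) *\<^sub>C ((z *\<^sub>C 1 - g) * (?w *\<^sub>C 1 - g)))"
    unfolding prod by (simp add: scaleC_simps algebra_simps)
  then have "z *\<^sub>C 1 - g \<notin> invertibles \<or> ?w *\<^sub>C 1 - g \<notin> invertibles"
    using assms mult_invertible by (auto simp: spectrum_iff minus_invertible scaleC_invertible)
  moreover have "t = z * (1 + z) / 2" "t = ?w * (1 + ?w) / 2"
    by (simp_all only: zz ww) simp_all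
  ultimately show thesis
    using that unfolding spectrum_iff by blast
qed

lemma one_in_spectrum_peak_polynomial:
  fixes g :: "'a::complex_banach_algebra"
  assumes "1 \<in> spectrum g"
  shows "1 \<in> spectrum ((1 / 2) *\<^sub>C (g * (1 + g)))"
proof (rule ccontr)
  assume "\<not> ?thesis"
  then have i: "1 - (1 / 2) *\<^sub>C (g * (1 + g)) \<in> invertibles" by (simp add: one_in_spectrum_iff)
  define q where "q = (1 / 2 :: complex) *\<^sub>C g"
  have g: "g = q + q" by (simp add: q_def scaleC_one flip: scaleC_add_left)
  have "(1 / 2) *\<^sub>C (g * (1 + g)) = q * (1 + g)" by (simp only: q_def mult_scaleC_left)
  with i have "1 - q * (1 + g) \<in> invertibles" by simp
  moreover have "(1 - g) * (1 + q) = 1 - q * (1 + g)" "(1 + q) * (1 - g) = 1 - q * (1 + g)"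
    unfolding g by (simp_all add: algebra_simps)
  ultimately have "(1 - g) * (1 + q) = (1 + q) * (1 - g)" "(1 - g) * (1 + q) \<in> invertibles"
    by simp_all
  then have "1 - g \<in> invertibles" by (rule commuting_factor_invertible)
  then show False using assms by (simp add: one_in_spectrum_iff)
qed

context spectral_bijection
begin

text \<open>
  Comparing the moduli of \<open>f (\<phi> x)\<close> gives \<open>\<bar>\<alpha>\<bar> = \<bar>\<beta>\<bar>\<close>. For the arguments choose \<open>g\<close> such that \<open>\<phi> x g\<close> is close
  to \<open>\<alpha> g\<close> and, for \<open>\<phi> h = g\<close>, also \<open>x h\<close> is close to \<open>\<beta> h\<close>, both in spectral radius. After rescaling and
  replacing \<open>g\<close> by \<open>g (1 + g) / 2\<close>, the spectrum of \<open>g\<close> and \<open>h\<close> contains \<open>1\<close> and lies in the image of the unit disc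
  under \<open>z (1 + z) / 2\<close>. Now \<open>\<beta> \<in> \<sigma> (\<beta> h)\<close> is close to \<open>\<sigma> (x h) = \<sigma> (\<phi> x g)\<close>, hence close to
  \<open>\<sigma> (\<alpha> g)\<close>. In the limit \<open>\<beta> = \<alpha> z (1 + z) / 2\<close> with \<open>\<bar>z\<bar> \<le> 1\<close>, and equality of the moduli forces \<open>z = 1\<close>.
\<close>

lemma values_agree:
  assumes f: "spectral_limit D f" and f1: "f 1 = 1" and x: "x \<in> C"
    and a: "f (\<phi> x - \<alpha> *\<^sub>C 1) = 0" and b: "f (\<phi> (x - \<beta> *\<^sub>C 1)) = 0"
  shows "\<alpha> = \<beta>"
proof -
  note [simp] = A.closed B.closed x image_closed
  have N: "spectral_limit C (f \<circ> \<phi>)" by (rule spectral_limit_transport[OF f])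
  have "f (\<phi> x) = cmod \<alpha>"
    using B.spectral_limit_diff[OF f, of "\<phi> x" "\<alpha> *\<^sub>C 1"] B.spectral_limit_diff[OF f, of "\<alpha> *\<^sub>C 1" "\<phi> x"]
      B.spectral_limit_scaleC[OF f B.one_closed, of \<alpha>] a f1 by simp
  moreover have "f (\<phi> x) = cmod \<beta>"
    using A.spectral_limit_diff[OF N, of x "\<beta> *\<^sub>C 1"] A.spectral_limit_diff[OF N, of "\<beta> *\<^sub>C 1" x]
      A.spectral_limit_scaleC[OF N A.one_closed, of \<beta>] b f1 image_one by simp
  ultimately have eq: "cmod \<alpha> = cmod \<beta>" by simp
  show ?thesis
  proof (cases "\<beta> = 0")
    case True
    then show ?thesis using eq by simp
  next
    case False
    then have \<alpha>: "\<alpha> \<noteq> 0" using eq by auto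
    define S where "S = (\<lambda>z. \<alpha> * (z * (1 + z) / 2)) ` cball 0 1"
    have "compact S" unfolding S_def
      by (intro compact_continuous_image continuous_intros) auto
    then have "closed S" by (rule compact_imp_closed)
    moreover have "\<beta> \<in> closure S"
      unfolding closure_approachable
    proof (intro allI impI)
      fix e :: real assume e: "0 < e"
      define e1 where "e1 = min (e / 8) (1 / 2)"
      have e1: "0 < e1" "e1 \<le> 1 / 2" "8 * e1 \<le> e" using e by (auto simp: e1_def)
      let ?X = "\<phi> x - \<alpha> *\<^sub>C 1" and ?Y = "\<phi> (x - \<beta> *\<^sub>C 1)"
      have "finite {1, ?X, ?Y}" "{1, ?X, ?Y} \<subseteq> D" by simp_all
      then obtain g where g: "g \<in> D" "\<And>z. z \<in> {1, ?X, ?Y} \<Longrightarrow> \<bar>f z - spectral_radius (z * g)\<bar> < e1"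
        using e1(1) by (rule spectral_limitD[OF f]) blast
      note [simp] = g(1)
      have gX: "spectral_radius (?X * g) < e1" and gY: "spectral_radius (?Y * g) < e1"
        and g1: "1 / 2 < spectral_radius g"
        using g(2)[of ?X] g(2)[of ?Y] g(2)[of 1] e1(2) a b f1 by auto
      obtain \<mu> where \<mu>: "\<mu> \<in> spectrum g" "cmod \<mu> = spectral_radius g"
        by (rule spectral_radius_attained)
      have \<mu>0: "\<mu> \<noteq> 0" using \<mu>(2) g1 by auto
      define g1 where "g1 = (1 / \<mu>) *\<^sub>C g"
      define k where "k = (1 / \<mu>) *\<^sub>C ((1 / 2) *\<^sub>C (1 + g1))"
      define g2 where "g2 = (1 / 2) *\<^sub>C (g1 * (1 + g1))"
      have D: "g1 \<in> D" "k \<in> D" "g2 \<in> D" by (simp_all add: g1_def k_def g2_def)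
      have "g1 * (1 + g1) = (1 / \<mu>) *\<^sub>C (g * (1 + g1))"
        by (simp only: g1_def mult_scaleC_left)
      then have g2: "g2 = g * k"
        by (simp add: g2_def k_def mult_scaleC_right scaleC_scaleC mult.commute)
      have rg1: "spectral_radius g1 = 1"
        using \<mu>0 by (simp add: g1_def spectral_radius_scaleC norm_divide flip: \<mu>(2))
      have one1: "1 \<in> spectrum g1" using \<mu>(1) \<mu>0 by (simp add: g1_def spectrum_scaleC_iff)
      have "spectral_radius (1 + g1) \<le> 2"
        using B.radius_add[OF B.one_closed D(1)] rg1 by simp
      then have "spectral_radius k \<le> 1 / cmod \<mu>"
        using \<mu>0 by (simp add: k_def spectral_radius_scaleC norm_divide divide_simps)
      also have "\<dots> \<le> 2" using g1 \<mu>(2) by (simp add: divide_simps)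
      finally have k: "spectral_radius k \<le> 2" .
      have small: "spectral_radius (z * g2) \<le> 2 * e1" if "z \<in> D" "spectral_radius (z * g) < e1" for z
      proof -
        have "spectral_radius (z * g2) = spectral_radius (z * g * k)" by (simp add: g2 mult.assoc)
        also have "\<dots> \<le> spectral_radius (z * g) * spectral_radius k"
          using that D by (intro B.radius_mult) simp_all
        also have "\<dots> \<le> e1 * 2" using that(2) k e1 by (intro mult_mono) auto
        finally show ?thesis by simp
      qed
      obtain h where h: "h \<in> C" "\<phi> h = g2" using preimage[OF D(3)] by blast
      note [simp] = h(1) D
      have "1 \<in> spectrum h"
        using one_in_spectrum_peak_polynomial[OF one1] spectrum[OF h(1)] h(2) by (simp add: g2_def)
      then have "\<beta> \<in> spectrum (\<beta> *\<^sub>C h)" using False by (simp add: spectrum_scaleC_iff)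
      then obtain \<nu> where \<nu>: "\<nu> \<in> spectrum (x * h)" "cmod (\<beta> - \<nu>) \<le> spectral_radius (\<beta> *\<^sub>C h - x * h)"
        using spectrum_perturbation[of "\<beta> *\<^sub>C h" "x * h"] A.commute[of "\<beta> *\<^sub>C h" "x * h"] by (metis A.mult_closed A.scaleC_closed h(1) x)
      have "spectral_radius (\<beta> *\<^sub>C h - x * h) = spectral_radius (- ((x - \<beta> *\<^sub>C 1) * h))"
        by (simp add: algebra_simps scaleC_simps)
      also have "\<dots> = spectral_radius (\<phi> ((x - \<beta> *\<^sub>C 1) * h))"
        by (simp add: spectral_radius_minus radius)
      also have "\<dots> \<le> 2 * e1"
        using small[OF _ gY] by (simp add: mult h(2))
      finally have d1: "cmod (\<beta> - \<nu>) \<le> 2 * e1" using \<nu>(2) by simp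
      have "\<nu> \<in> spectrum (\<phi> x * g2)" using \<nu>(1) spectrum[of "x * h"] by (simp add: mult h(2))
      then obtain \<kappa> where \<kappa>: "\<kappa> \<in> spectrum (\<alpha> *\<^sub>C g2)" "cmod (\<nu> - \<kappa>) \<le> spectral_radius (\<phi> x * g2 - \<alpha> *\<^sub>C g2)"
        using spectrum_perturbation[of "\<phi> x * g2" "\<alpha> *\<^sub>C g2"] B.commute[of "\<phi> x * g2" "\<alpha> *\<^sub>C g2"]
        by (metis B.mult_closed B.scaleC_closed D(3) x image_closed)
      have "spectral_radius (\<phi> x * g2 - \<alpha> *\<^sub>C g2) = spectral_radius (?X * g2)"
        by (simp add: algebra_simps scaleC_simps)
      also have "\<dots> \<le> 2 * e1" using small[OF _ gX] by simp
      finally have d2: "cmod (\<nu> - \<kappa>) \<le> 2 * e1" using \<kappa>(2) by simp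
      have "\<kappa> / \<alpha> \<in> spectrum g2" using \<kappa>(1) \<alpha> by (simp add: spectrum_scaleC_iff)
      then obtain z where z: "z \<in> spectrum g1" "\<kappa> / \<alpha> = z * (1 + z) / 2"
        unfolding g2_def by (rule spectrum_peak_polynomial)
      have "cmod z \<le> 1" using spectrum_le_spectral_radius[OF z(1)] rg1 by simp
      moreover have "\<kappa> = \<alpha> * (z * (1 + z) / 2)" using z(2) \<alpha> by (simp add: field_simps)
      ultimately have "\<kappa> \<in> S" by (auto simp: S_def)
      moreover have "dist \<kappa> \<beta> < e"
        using d1 d2 e1 norm_triangle_ineq[of "\<beta> - \<nu>" "\<nu> - \<kappa>"]
        by (simp add: dist_norm norm_minus_commute[of \<kappa>])
      ultimately show "\<exists>y\<in>S. dist y \<beta> < e" by blast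
    qed
    ultimately have "\<beta> \<in> S" by simp
    then obtain z where z: "cmod z \<le> 1" "\<beta> = \<alpha> * (z * (1 + z) / 2)" by (auto simp: S_def)
    have "cmod \<alpha> * cmod (z * (1 + z) / 2) = cmod \<alpha> * 1"
      using z(2) eq by (metis mult.right_neutral norm_mult)
    then have "cmod (z * (1 + z) / 2) = 1" using \<alpha> by simp
    then have "z = 1" using modulus_peaked_at_one[OF z(1)] by simp
    then show ?thesis using z(2) by simp
  qed
qed

text \<open>
  Let \<open>f\<close> be multiplicative and peaking at the normalized defect \<open>c d\<close>. The characters given by \<open>f\<close> and
  \<open>f \<circ> \<phi>\<close> take the same values at \<open>\<phi> z\<close> and \<open>z\<close>. Additivity of the second one at \<open>x\<close> and \<open>y\<close> thus shows that
  the first one vanishes at \<open>d\<close>.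
\<close>

theorem additive_modulo_quasinilpotents:
  assumes x: "x \<in> C" and y: "y \<in> C"
  shows "spectral_radius (\<phi> (x + y) - \<phi> x - \<phi> y) = 0"
proof (rule ccontr)
  note [simp] = A.closed B.closed x y image_closed
  let ?d = "\<phi> (x + y) - \<phi> x - \<phi> y"
  let ?c = "complex_of_real (1 / spectral_radius ?d)"
  assume nz: "spectral_radius ?d \<noteq> 0"
  then have "spectral_radius (?c *\<^sub>C ?d) = 1"
    by (simp add: spectral_radius_scaleC norm_divide)
  moreover have "?c *\<^sub>C ?d \<in> D" by simp
  ultimately obtain f where f: "spectral_limit D f" "f 1 = 1" "f (?c *\<^sub>C ?d) = 1"
    and fm: "\<And>x y. x \<in> D \<Longrightarrow> y \<in> D \<Longrightarrow> f (x * y) = f x * f y"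
    using B.multiplicative_peak_seminorm_exists by metis
  have N: "spectral_limit C (f \<circ> \<phi>)" by (rule spectral_limit_transport[OF f(1)])
  have Nm: "(f \<circ> \<phi>) (x * y) = (f \<circ> \<phi>) x * (f \<circ> \<phi>) y" if "x \<in> C" "y \<in> C" for x y
    using that by (simp add: mult fm)
  have N1: "(f \<circ> \<phi>) 1 = 1" using f(2) image_one by simp
  have "\<exists>\<alpha>. f (\<phi> z - \<alpha> *\<^sub>C 1) = 0 \<and> (f \<circ> \<phi>) (z - \<alpha> *\<^sub>C 1) = 0" if z: "z \<in> C" for z
  proof -
    obtain \<alpha> where \<alpha>: "f (\<phi> z - \<alpha> *\<^sub>C 1) = 0"
      using B.multiplicative_seminorm_has_value[where f = f, OF f(1,2) fm image_closed[OF z]] by (rule exE)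
    obtain \<beta> where \<beta>: "(f \<circ> \<phi>) (z - \<beta> *\<^sub>C 1) = 0"
      using A.multiplicative_seminorm_has_value[where f = "f \<circ> \<phi>", OF N N1 Nm z] by (rule exE)
    have "\<alpha> = \<beta>" using values_agree[OF f(1,2) z \<alpha>] \<beta> by simp
    then show ?thesis using \<alpha> \<beta> by blast
  qed
  then obtain \<alpha> \<beta> \<gamma> where \<alpha>: "f (\<phi> x - \<alpha> *\<^sub>C 1) = 0" "(f \<circ> \<phi>) (x - \<alpha> *\<^sub>C 1) = 0"
    and \<beta>: "f (\<phi> y - \<beta> *\<^sub>C 1) = 0" "(f \<circ> \<phi>) (y - \<beta> *\<^sub>C 1) = 0"
    and \<gamma>: "f (\<phi> (x + y) - \<gamma> *\<^sub>C 1) = 0"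
    by (meson A.add_closed x y)
  have "(f \<circ> \<phi>) (x + y - (\<alpha> + \<beta>) *\<^sub>C 1) = (f \<circ> \<phi>) ((x - \<alpha> *\<^sub>C 1) + (y - \<beta> *\<^sub>C 1))"
    by (simp add: scaleC_simps algebra_simps)
  also have "\<dots> \<le> (f \<circ> \<phi>) (x - \<alpha> *\<^sub>C 1) + (f \<circ> \<phi>) (y - \<beta> *\<^sub>C 1)"
    by (rule A.spectral_limit_add[OF N]) simp_all
  finally have "(f \<circ> \<phi>) (x + y - (\<alpha> + \<beta>) *\<^sub>C 1) = 0"
    using A.spectral_limit_nonneg[OF N, of "x + y - (\<alpha> + \<beta>) *\<^sub>C 1"] \<alpha>(2) \<beta>(2) by simp
  then have \<gamma>_eq: "\<gamma> = \<alpha> + \<beta>"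
    using values_agree[OF f(1,2) _ \<gamma>] by simp
  have "?d = (\<phi> (x + y) - \<gamma> *\<^sub>C 1) - (\<phi> x - \<alpha> *\<^sub>C 1) - (\<phi> y - \<beta> *\<^sub>C 1)"
    unfolding \<gamma>_eq by (simp add: scaleC_simps algebra_simps)
  also have "f \<dots> \<le> f (\<phi> (x + y) - \<gamma> *\<^sub>C 1) + f (\<phi> x - \<alpha> *\<^sub>C 1) + f (\<phi> y - \<beta> *\<^sub>C 1)"
    by (intro order_trans[OF B.spectral_limit_diff(1)[OF f(1)]] add_right_mono
        B.spectral_limit_diff(1)[OF f(1)]) simp_all
  finally have "f ?d \<le> 0" using \<alpha>(1) \<beta>(1) \<gamma> by simp
  then have "f ?d = 0" using B.spectral_limit_nonneg[OF f(1), of ?d] by simp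
  then show False
    using f(3) B.spectral_limit_scaleC[OF f(1), of ?d ?c] by simp
qed

end

section \<open>Quotients by the radical\<close>

locale inverse_closed_subalgebra = commutative_subalgebra +
  assumes ainv_closed: "x \<in> D \<Longrightarrow> x \<in> invertibles \<Longrightarrow> ainv x \<in> D"
begin

lemma unital_subring: "unital_subring D"
  by (simp add: unital_subring_def closed)

text \<open>
  In a commutative algebra the spectral radius is submultiplicative, so the multiples of a quasinilpotent
  element are quasinilpotent; inverses stay in the subalgebra.
\<close>

lemma Rad_iff: "x \<in> Rad D \<longleftrightarrow> x \<in> D \<and> spectral_radius x = 0"
proof
  assume "x \<in> Rad D"
  then have x: "x \<in> D" "\<And>y. y \<in> D \<Longrightarrow> \<exists>z\<in>D. z * (1 - y * x) = 1"
    using Rad_iff_left_invertible[OF unital_subring, of x] by blast+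
  obtain z where z: "z \<in> spectrum x" "cmod z = spectral_radius x"
    by (rule spectral_radius_attained)
  have "z = 0"
  proof (rule ccontr)
    assume "z \<noteq> 0"
    let ?p = "1 - ((1 / z) *\<^sub>C 1) * x"
    obtain u where u: "u \<in> D" "u * ?p = 1" using x(2)[OF scaleC_closed[OF one_closed]] by blast
    moreover have "?p * u = u * ?p" using u(1) x(1) by (intro commute) (simp_all add: closed)
    ultimately have "?p \<in> invertibles" by (intro invertiblesI[of _ u]) simp_all
    then show False
      using z(1) spectrum_iff_nonzero[OF \<open>z \<noteq> 0\<close>, of x] by (simp add: mult_scaleC_left)
  qed
  then show "x \<in> D \<and> spectral_radius x = 0" using x(1) z(2) by simp
next
  assume x: "x \<in> D \<and> spectral_radius x = 0"
  have "\<exists>z\<in>D. z * (1 - y * x) = 1" if y: "y \<in> D" for y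
  proof -
    have "spectral_radius (y * x) \<le> 0" using radius_mult[OF y, of x] x by simp
    then have "1 \<notin> spectrum (y * x)" using spectrum_le_spectral_radius[of 1 "y * x"] by auto
    then have i: "1 - y * x \<in> invertibles" by (simp add: one_in_spectrum_iff)
    moreover have "ainv (1 - y * x) \<in> D" using i x y by (intro ainv_closed) (simp_all add: closed)
    ultimately show ?thesis using ainv_left by blast
  qed
  then show "x \<in> Rad D" using Rad_iff_left_invertible[OF unital_subring, of x] x by blast
qed

lemma Rad_closed:
  shows "0 \<in> Rad D" "x \<in> Rad D \<Longrightarrow> y \<in> Rad D \<Longrightarrow> x + y \<in> Rad D" "x \<in> Rad D \<Longrightarrow> - x \<in> Rad D"
    "x \<in> Rad D \<Longrightarrow> y \<in> D \<Longrightarrow> y * x \<in> Rad D" "x \<in> Rad D \<Longrightarrow> c *\<^sub>C x \<in> Rad D" "x \<in> Rad D \<Longrightarrow> x \<in> D"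
proof -
  show "0 \<in> Rad D" "x \<in> Rad D \<Longrightarrow> - x \<in> Rad D" "x \<in> Rad D \<Longrightarrow> c *\<^sub>C x \<in> Rad D" "x \<in> Rad D \<Longrightarrow> x \<in> D"
    by (auto simp: Rad_iff closed spectral_radius_minus spectral_radius_scaleC)
  show "x + y \<in> Rad D" if "x \<in> Rad D" "y \<in> Rad D"
    using radius_add[of x y] that by (simp add: Rad_iff closed)
  show "y * x \<in> Rad D" if "x \<in> Rad D" "y \<in> D"
    using radius_mult[of y x] that by (simp add: Rad_iff closed)
qed

definition coset :: "'a \<Rightarrow> 'a set" where
  "coset a = {b \<in> D. b - a \<in> Rad D}"

lemma coset_self: "a \<in> D \<Longrightarrow> a \<in> coset a"
  by (simp add: coset_def Rad_closed)

lemma coset_eq_iff: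
  assumes "a \<in> D" "b \<in> D"
  shows "coset a = coset b \<longleftrightarrow> a - b \<in> Rad D"
proof
  assume "coset a = coset b"
  then show "a - b \<in> Rad D" using coset_self[OF assms(1)] by (simp add: coset_def)
next
  assume ab: "a - b \<in> Rad D"
  have "x - a \<in> Rad D \<longleftrightarrow> x - b \<in> Rad D" for x
    using Rad_closed(2)[OF _ ab, of "x - a"] Rad_closed(2)[OF _ Rad_closed(3)[OF ab], of "x - b"] by auto
  then show "coset a = coset b" by (simp add: coset_def)
qed

lemma a_r_coset_eq:
  assumes "a \<in> D"
  shows "Rad D +>\<^bsub>subring_of D\<^esub> a = coset a"
proof -
  have "x \<in> coset a \<longleftrightarrow> (\<exists>i\<in>Rad D. x = i + a)" for x
  proof
    assume "x \<in> coset a"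
    then show "\<exists>i\<in>Rad D. x = i + a" by (intro bexI[of _ "x - a"]) (simp_all add: coset_def)
  next
    assume "\<exists>i\<in>Rad D. x = i + a"
    then show "x \<in> coset a" using assms by (auto simp: coset_def closed Rad_closed)
  qed
  then show ?thesis by (auto simp: a_r_coset_def' subring_of_def)
qed

lemma carrier_quotient: "carrier (quotient_algebra D (Rad D)) = coset ` D"
proof -
  have "carrier (quotient_algebra D (Rad D)) = (\<lambda>a. Rad D +>\<^bsub>subring_of D\<^esub> a) ` D"
    by (auto simp: quotient_algebra_def ring.defs FactRing_def A_RCOSETS_def' subring_of_def)
  then show ?thesis by (simp add: a_r_coset_eq)
qed

lemma one_quotient: "\<one>\<^bsub>quotient_algebra D (Rad D)\<^esub> = coset 1"
proof -
  have "\<one>\<^bsub>quotient_algebra D (Rad D)\<^esub> = Rad D +>\<^bsub>subring_of D\<^esub> 1"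
    by (simp add: quotient_algebra_def ring.defs FactRing_def subring_of_def)
  then show ?thesis by (simp add: a_r_coset_eq closed)
qed

lemma mult_quotient:
  assumes "a \<in> D" "b \<in> D"
  shows "coset a \<otimes>\<^bsub>quotient_algebra D (Rad D)\<^esub> coset b = coset (a * b)"
proof -
  have "coset a \<otimes>\<^bsub>quotient_algebra D (Rad D)\<^esub> coset b
      = (\<Union>x\<in>coset a. \<Union>y\<in>coset b. Rad D +>\<^bsub>subring_of D\<^esub> (x * y))"
    by (simp add: quotient_algebra_def ring.defs FactRing_def rcoset_mult_def subring_of_def)
  also have "\<dots> = (\<Union>x\<in>coset a. \<Union>y\<in>coset b. coset (a * b))"
  proof (intro SUP_cong refl)
    fix x y assume xy: "x \<in> coset a" "y \<in> coset b"
    then have m: "x \<in> D" "y \<in> D" "x - a \<in> Rad D" "y - b \<in> Rad D" by (auto simp: coset_def)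
    have "x * y - a * b = y * (x - a) + a * (y - b)"
      using commute[OF m(1,2)] commute[OF m(2) assms(1)] by (simp add: algebra_simps)
    then have "x * y - a * b \<in> Rad D" using m assms by (simp add: Rad_closed)
    then show "Rad D +>\<^bsub>subring_of D\<^esub> (x * y) = coset (a * b)"
      using m assms by (simp add: a_r_coset_eq closed coset_eq_iff)
  qed
  also have "\<dots> = coset (a * b)" using coset_self assms by auto
  finally show ?thesis .
qed

lemma add_quotient:
  assumes "a \<in> D" "b \<in> D"
  shows "coset a \<oplus>\<^bsub>quotient_algebra D (Rad D)\<^esub> coset b = coset (a + b)"
proof -
  have "coset a \<oplus>\<^bsub>quotient_algebra D (Rad D)\<^esub> coset b = (\<Union>x\<in>coset a. \<Union>y\<in>coset b. {x + y})"
    by (simp add: quotient_algebra_def ring.defs FactRing_def set_add_def' subring_of_def)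
  also have "\<dots> = coset (a + b)"
  proof (intro equalityI subsetI)
    fix z assume "z \<in> (\<Union>x\<in>coset a. \<Union>y\<in>coset b. {x + y})"
    then obtain x y where m: "z = x + y" "x \<in> D" "y \<in> D" "x - a \<in> Rad D" "y - b \<in> Rad D"
      by (auto simp: coset_def)
    have eq: "z - (a + b) = (x - a) + (y - b)" by (simp add: m(1))
    have "z - (a + b) \<in> Rad D" unfolding eq by (rule Rad_closed(2)[OF m(4,5)])
    moreover have "z \<in> D" using m by (simp add: closed)
    ultimately show "z \<in> coset (a + b)" by (simp add: coset_def)
  next
    fix z assume z: "z \<in> coset (a + b)"
    then have "z - b \<in> coset a" using assms by (simp add: coset_def closed algebra_simps)
    then show "z \<in> (\<Union>x\<in>coset a. \<Union>y\<in>coset b. {x + y})"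
      using coset_self[OF assms(2)] by (intro UN_I[of "z - b"] UN_I[of b]) simp_all
  qed
  finally show ?thesis .
qed

lemma smult_quotient:
  assumes "a \<in> D"
  shows "c \<odot>\<^bsub>quotient_algebra D (Rad D)\<^esub> coset a = coset (c *\<^sub>C a)"
proof -
  have "c \<odot>\<^bsub>quotient_algebra D (Rad D)\<^esub> coset a = (\<Union>x\<in>coset a. Rad D +>\<^bsub>subring_of D\<^esub> (c *\<^sub>C x))"
    by (simp add: quotient_algebra_def ring.defs)
  also have "\<dots> = (\<Union>x\<in>coset a. coset (c *\<^sub>C a))"
  proof (intro SUP_cong refl)
    fix x assume "x \<in> coset a"
    then have m: "x \<in> D" "x - a \<in> Rad D" by (auto simp: coset_def)
    have "c *\<^sub>C x - c *\<^sub>C a \<in> Rad D"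
      using Rad_closed(5)[OF m(2), of c] by (simp add: scaleC_diff_right)
    then show "Rad D +>\<^bsub>subring_of D\<^esub> (c *\<^sub>C x) = coset (c *\<^sub>C a)"
      using m assms by (simp add: a_r_coset_eq closed coset_eq_iff)
  qed
  also have "\<dots> = coset (c *\<^sub>C a)" using coset_self[OF assms] by auto
  finally show ?thesis .
qed

end

context spectral_bijection
begin

text \<open>
  Up to a quasinilpotent error, \<open>\<phi> a - \<phi> b\<close> is \<open>\<phi> (a - b)\<close>.
\<close>

lemma radius_difference:
  assumes a: "a \<in> C" and b: "b \<in> C"
  shows "spectral_radius (\<phi> a - \<phi> b) = spectral_radius (a - b)"
proof -
  note [simp] = A.closed B.closed a b image_closed
  let ?e = "\<phi> a - \<phi> b - \<phi> (a - b)"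
  have e: "spectral_radius ?e = 0"
    using additive_modulo_quasinilpotents[of b "a - b"] by simp
  then have e': "spectral_radius (\<phi> (a - b) - (\<phi> a - \<phi> b)) = 0"
    using spectral_radius_minus[of ?e] by simp
  have "spectral_radius (\<phi> a - \<phi> b) \<le> spectral_radius (\<phi> (a - b)) + spectral_radius ?e"
    using B.radius_add[of "\<phi> (a - b)" ?e] by simp
  moreover have "spectral_radius (\<phi> (a - b)) \<le> spectral_radius (\<phi> a - \<phi> b) + spectral_radius (- ?e)"
    using B.radius_add[of "\<phi> a - \<phi> b" "- ?e"] by simp
  ultimately show ?thesis using e e' by (simp add: radius)
qed

text \<open>
  By \<open>radius_difference\<close>, \<open>\<phi>\<close> maps congruent elements to congruent elements, and only those. The induced map is
  written as a union over the coset; all members of this union coincide.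
\<close>

theorem quotients_isomorphic:
  assumes C: "inverse_closed_subalgebra C" and D: "inverse_closed_subalgebra D"
  shows "algebra_isomorphic (quotient_algebra C (Rad C)) (quotient_algebra D (Rad D))"
proof -
  interpret A: inverse_closed_subalgebra C by (rule C)
  interpret B: inverse_closed_subalgebra D by (rule D)
  let ?QC = "quotient_algebra C (Rad C)" and ?QD = "quotient_algebra D (Rad D)"
  note [simp] = A.closed B.closed image_closed
  define h where "h X = (\<Union>a\<in>X. B.coset (\<phi> a))" for X
  have same: "B.coset (\<phi> a) = B.coset (\<phi> b) \<longleftrightarrow> A.coset a = A.coset b" if "a \<in> C" "b \<in> C" for a b
    using that by (simp add: A.coset_eq_iff B.coset_eq_iff A.Rad_iff B.Rad_iff radius_difference)
  have h: "h (A.coset a) = B.coset (\<phi> a)" if a: "a \<in> C" for a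
  proof -
    have "B.coset (\<phi> b) = B.coset (\<phi> a)" if b: "b \<in> A.coset a" for b
    proof -
      have m: "b \<in> C" "b - a \<in> Rad C" using b by (auto simp: A.coset_def)
      then show ?thesis using a by (simp add: same A.coset_eq_iff)
    qed
    then show ?thesis unfolding h_def using A.coset_self[OF a] by blast
  qed
  have "h \<in> ring_hom ?QC ?QD"
  proof (rule ring_hom_memI)
    fix X assume "X \<in> carrier ?QC"
    then obtain a where a: "a \<in> C" "X = A.coset a" by (auto simp: A.carrier_quotient)
    then show "h X \<in> carrier ?QD" by (simp add: h B.carrier_quotient)
    fix Y assume "Y \<in> carrier ?QC"
    then obtain b where b: "b \<in> C" "Y = A.coset b" by (auto simp: A.carrier_quotient)
    show "h (X \<otimes>\<^bsub>?QC\<^esub> Y) = h X \<otimes>\<^bsub>?QD\<^esub> h Y"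
      using a b by (simp add: h A.mult_quotient B.mult_quotient mult)
    have "B.coset (\<phi> (a + b)) = B.coset (\<phi> a + \<phi> b)"
      using a b additive_modulo_quasinilpotents[of a b]
      by (simp add: B.coset_eq_iff B.Rad_iff diff_diff_eq)
    then show "h (X \<oplus>\<^bsub>?QC\<^esub> Y) = h X \<oplus>\<^bsub>?QD\<^esub> h Y"
      using a b by (simp add: h A.add_quotient B.add_quotient)
  next
    show "h \<one>\<^bsub>?QC\<^esub> = \<one>\<^bsub>?QD\<^esub>" by (simp add: h A.one_quotient B.one_quotient image_one)
  qed
  moreover have "bij_betw h (carrier ?QC) (carrier ?QD)"
    unfolding bij_betw_def
  proof
    show "inj_on h (carrier ?QC)"
      by (auto simp: inj_on_def A.carrier_quotient h same)
    have "h ` carrier ?QC = (\<lambda>a. B.coset (\<phi> a)) ` C"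
      unfolding A.carrier_quotient image_image by (rule image_cong) (simp_all add: h)
    also have "\<dots> = B.coset ` D"
      using bij by (auto simp: bij_betw_def)
    finally show "h ` carrier ?QC = carrier ?QD" by (simp add: B.carrier_quotient)
  qed
  ultimately have "h \<in> ring_iso ?QC ?QD" by (simp add: ring_iso_def)
  moreover have "h (c \<odot>\<^bsub>?QC\<^esub> X) = c \<odot>\<^bsub>?QD\<^esub> h X" if "X \<in> carrier ?QC" for c X
    using that by (auto simp: A.carrier_quotient A.smult_quotient B.smult_quotient h scaleC)
  ultimately show ?thesis unfolding algebra_isomorphic_def by blast
qed

end

section \<open>Bicommutants\<close>

lemma bicommutant_singleton_iff:
  "z \<in> bicommutant {x} \<longleftrightarrow> (\<forall>w. w * x = x * w \<longrightarrow> z * w = w * z)"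
  by (auto simp: bicommutant_def commutant_def)

text \<open>
  Elements of the bicommutant of \<open>x\<close> commute with \<open>x\<close>, so they belong to the commutant of \<open>x\<close> and commute with
  each other.
\<close>

lemma inverse_closed_bicommutant:
  "inverse_closed_subalgebra (bicommutant {x::'a::complex_banach_algebra})"
proof unfold_locales
  fix u v :: 'a assume u: "u \<in> bicommutant {x}" and v: "v \<in> bicommutant {x}"
  have uw: "u * w = w * u" and vw: "v * w = w * v" if "w * x = x * w" for w
    using u v that by (auto simp: bicommutant_singleton_iff)
  show "u * v = v * u" using uw[of v] vw[of x] by simp
  show "u + v \<in> bicommutant {x}"
    using uw vw by (simp add: bicommutant_singleton_iff distrib_left distrib_right)
  have "u * v * w = w * (u * v)" if "w * x = x * w" for w
  proof -
    have "u * v * w = u * w * v" by (simp add: mult.assoc vw[OF that])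
    then show ?thesis by (simp add: uw[OF that] mult.assoc)
  qed
  then show "u * v \<in> bicommutant {x}" by (simp add: bicommutant_singleton_iff)
next
  fix u :: 'a and c assume u: "u \<in> bicommutant {x}"
  then show "c *\<^sub>C u \<in> bicommutant {x}"
    by (auto simp: bicommutant_singleton_iff mult_scaleC_left mult_scaleC_right)
  assume "u \<in> invertibles"
  then have "w * ainv u = ainv u * w" if "w * u = u * w" for w
    using commute_ainv that by blast
  then show "ainv u \<in> bicommutant {x}"
    using u unfolding bicommutant_singleton_iff by metis
qed (simp add: bicommutant_singleton_iff)

section \<open>Spectrally multiplicative maps\<close>

lemma semisimple_determined_by_spectra:
  fixes a b :: "'a::complex_banach_algebra"
  assumes "semisimple TYPE('a)" "\<And>x. spectrum (a * x) = spectrum (b * x)"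
  shows "a = b"
  using difference_in_Rad[OF assms(2)] assms(1) by (simp add: semisimple_def)

lemma spectrum_of_Rad_multiple:
  assumes "b \<in> Rad (UNIV :: 'a::complex_banach_algebra set)"
  shows "spectrum (b * x) = {0}"
proof -
  have "z \<notin> spectrum (b * x)" if "z \<noteq> 0" for z
  proof -
    have "1 - b * ((1 / z) *\<^sub>C x) \<in> invertibles"
      using assms by (simp only: Rad_UNIV_iff)
    then show ?thesis using spectrum_iff_nonzero[OF that, of "b * x"] by (simp add: mult_scaleC_right)
  qed
  then have "spectrum (b * x) \<subseteq> {0}" by auto
  then show ?thesis using spectrum_nonempty[of "b * x"] by (simp add: subset_singleton_iff)
qed

lemma spectrum_scaleC_cong:
  assumes "spectrum x = spectrum y"
  shows "spectrum (c *\<^sub>C x) = spectrum (c *\<^sub>C y)"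
proof (cases "c = 0")
  case True
  then show ?thesis by (simp add: spectrum_zero)
next
  case False
  then show ?thesis using assms by (auto simp: spectrum_scaleC_iff)
qed

theorem theorem1p4:
  fixes \<phi> :: "'a::complex_banach_algebra \<Rightarrow> 'b::complex_banach_algebra"
  assumes semisimple_A: "semisimple TYPE('a)"
    and surj: "surj \<phi>"
    and spec: "\<And>xs :: 'a list. length xs \<in> {1, 2, 3} \<Longrightarrow>
                 spectrum (prod_list (map \<phi> xs)) = spectrum (prod_list xs)"
  shows "bij \<phi> \<and>
    semisimple TYPE('b) \<and>
    (\<forall>x y. \<phi> (x * y) = \<phi> x * \<phi> y) \<and>
    (\<phi> 1 = 1 \<and> (\<forall>x c. \<phi> (c *\<^sub>C x) = c *\<^sub>C \<phi> x)) \<and>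
    (\<forall>x y. x * y = y * x \<longleftrightarrow> \<phi> x * \<phi> y = \<phi> y * \<phi> x) \<and>
    (\<forall>x y. y \<in> bicommutant {x} \<longleftrightarrow> \<phi> y \<in> bicommutant {\<phi> x}) \<and>
    (\<forall>x. algebra_isomorphic
       (quotient_algebra (bicommutant {x}) (Rad (bicommutant {x})))
       (quotient_algebra (bicommutant {\<phi> x}) (Rad (bicommutant {\<phi> x}))))"
proof -
  have s1: "spectrum (\<phi> x) = spectrum x" for x
    using spec[of "[x]"] by simp
  have s2: "spectrum (\<phi> x * \<phi> y) = spectrum (x * y)" for x y
    using spec[of "[x, y]"] by simp
  have s3: "spectrum (\<phi> x * \<phi> y * \<phi> z) = spectrum (x * y * z)" for x y z
    using spec[of "[x, y, z]"] by (simp add: mult.assoc)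
  have inj: "inj \<phi>"
  proof (rule injI)
    fix x y assume "\<phi> x = \<phi> y"
    then show "x = y"
      using s2 by (intro semisimple_determined_by_spectra[OF semisimple_A]) metis
  qed
  with surj have bij: "bij \<phi>" by (simp add: bij_def)
  have Rad_B: "b = \<phi> 0" if "b \<in> Rad UNIV" for b
  proof -
    obtain x where x: "b = \<phi> x" using surj by blast
    have "spectrum (x * y) = spectrum (0 * y)" for y
      using spectrum_of_Rad_multiple[OF that, of "\<phi> y"] s2[of x y] by (simp add: x spectrum_zero)
    then have "x = 0" by (rule semisimple_determined_by_spectra[OF semisimple_A])
    then show ?thesis using x by simp
  qed
  have zero: "(0::'b) \<in> Rad UNIV" by (rule Rad_zero) simp
  have "Rad (UNIV :: 'b set) = {0}"
  proof (intro equalityI subsetI)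
    fix b :: 'b assume "b \<in> Rad UNIV"
    then show "b \<in> {0}" using Rad_B[of b] Rad_B[OF zero] by simp
  qed (use zero in simp)
  then have semisimple_B: "semisimple TYPE('b)" by (simp add: semisimple_def)
  \<comment> \<open>Every element of the second algebra is a value of \<open>\<phi>\<close>, so it suffices to test with these.\<close>
  have determined: "a = b" if "\<And>z. spectrum (a * \<phi> z) = spectrum (b * \<phi> z)" for a b
    using that surj by (intro semisimple_determined_by_spectra[OF semisimple_B]) (metis surjD)
  have mult: "\<phi> (x * y) = \<phi> x * \<phi> y" for x y
    by (rule determined) (simp only: s2 s3)
  have one: "\<phi> 1 = 1"
  proof -
    obtain e where "1 = \<phi> e" using surj by blast
    then show ?thesis using mult[of 1 e] by simp
  qed
  have scale: "\<phi> (c *\<^sub>C x) = c *\<^sub>C \<phi> x" for c x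
  proof (rule determined)
    fix z
    have "spectrum (c *\<^sub>C \<phi> x * \<phi> z) = spectrum (c *\<^sub>C (x * z))"
      unfolding mult_scaleC_left by (rule spectrum_scaleC_cong) (rule s2)
    then show "spectrum (\<phi> (c *\<^sub>C x) * \<phi> z) = spectrum (c *\<^sub>C \<phi> x * \<phi> z)"
      by (simp only: s2 mult_scaleC_left)
  qed
  have comm: "x * y = y * x \<longleftrightarrow> \<phi> x * \<phi> y = \<phi> y * \<phi> x" for x y
    by (simp add: inj_eq[OF inj] flip: mult)
  have bicomm: "y \<in> bicommutant {x} \<longleftrightarrow> \<phi> y \<in> bicommutant {\<phi> x}" for x y
  proof
    assume "y \<in> bicommutant {x}"
    then have y: "y * w = w * y" if "w * x = x * w" for w
      using that by (simp add: bicommutant_singleton_iff)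
    have "\<phi> y * w = w * \<phi> y" if "w * \<phi> x = \<phi> x * w" for w
    proof -
      obtain v where v: "w = \<phi> v" using surj by blast
      then show ?thesis using that y[of v] comm[of v x] comm[of y v] by simp
    qed
    then show "\<phi> y \<in> bicommutant {\<phi> x}" by (simp add: bicommutant_singleton_iff)
  next
    assume "\<phi> y \<in> bicommutant {\<phi> x}"
    then have "y * w = w * y" if "w * x = x * w" for w
      using that comm[of w x] comm[of y w] by (simp add: bicommutant_singleton_iff)
    then show "y \<in> bicommutant {x}" by (simp add: bicommutant_singleton_iff)
  qed
  have "algebra_isomorphic
       (quotient_algebra (bicommutant {x}) (Rad (bicommutant {x})))
       (quotient_algebra (bicommutant {\<phi> x}) (Rad (bicommutant {\<phi> x})))" for x
  proof -
    have C: "inverse_closed_subalgebra (bicommutant {x})"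
      and D: "inverse_closed_subalgebra (bicommutant {\<phi> x})"
      by (rule inverse_closed_bicommutant)+
    interpret A: inverse_closed_subalgebra "bicommutant {x}" by (rule C)
    interpret B: inverse_closed_subalgebra "bicommutant {\<phi> x}" by (rule D)
    have "\<phi> ` bicommutant {x} = bicommutant {\<phi> x}"
    proof (intro equalityI subsetI)
      fix w assume "w \<in> bicommutant {\<phi> x}"
      moreover obtain v where "w = \<phi> v" using surj by blast
      ultimately show "w \<in> \<phi> ` bicommutant {x}" using bicomm by blast
    qed (use bicomm in blast)
    then have "bij_betw \<phi> (bicommutant {x}) (bicommutant {\<phi> x})"
      using inj by (auto simp: bij_betw_def intro: inj_on_subset)
    then interpret spectral_bijection "bicommutant {x}" "bicommutant {\<phi> x}" \<phi>
      by unfold_locales (simp_all add: mult scale s1)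
    show ?thesis by (rule quotients_isomorphic[OF C D])
  qed
  then show ?thesis
    using bij semisimple_B mult one scale comm bicomm by blast
qed

end
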